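(* Let $A=\{\sigma_1,\dots,\sigma_d\}$ be a permutation group that is a subgroup of $S_n$. (1) If $A$ is permutation summable, then $A$ is exact. (2) If the toric ideal $I_A$ associated to $A$ has a quadratically generated Gröbner basis with respect to every reverse lexicographic ordering $\prec$, then $A$ is exact.
   Context: $A$ is identified with the set of $n\times n$ permutation matrices $\{P_{\sigma_1},\dots,P_{\sigma_d}\}\subseteq\mathbb{Z}^{n\times n}$, a finite real variety in $\mathbb{R}^{n\times n}$. Permutation summable: for any $P_1,\dots,P_m\in A$ (repetitions allowed) satisfying $\sum_{i=1}^mP_i-I\ge0$ entrywise ($I$ the identity matrix), the matrix $\sum_{i=1}^mP_i-I$ is also a sum of permutation matrices in $A$ (repetitions and the empty sum allowed). Toric ideal: $I_A$ is the kernel of the $\mathbb{C}$-algebra homomorphism $\pi:\mathbb{C}[x_{\sigma_1},\dots,x_{\sigma_d}]\to\mathbb{C}[t_{jk}:1\le j,k\le n]$, $\pi(x_{\sigma_i})=\prod_{1\le j,k\le n}t_{jk}^{(P_{\sigma_i})_{jk}}$. A reverse lexicographic ordering means a (graded) reverse lexicographic term order associated to some ordering of the variables $x_{\sigma_1},\dots,x_{\sigma_d}$. "Quadratically generated" means consisting of polynomials of degree two. Exact: let $I\subseteq\mathbb{R}[P_{i,j}:1\le i,j\le n]$ be the (real radical) ideal of all polynomials vanishing on the set of matrices $A$. A polynomial $f$ is $1$-sos mod $I$ if there are polynomials $h_1,\dots,h_r$ of degree at most $1$ with $f-\sum_ih_i^2\in I$. The first theta body is $TH_1(I)=\{x\in\mathbb{R}^{n\times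 n}: f(x)\ge0\text{ for every polynomial }f\text{ of degree at most }1\text{ that is }1\text{-sos mod }I\}$. $A$ is exact if $\mathrm{conv}(A)=TH_1(I)$. *)

theory Defs
  imports
    "HOL-Analysis.Analysis"
    "HOL-Library.Poly_Mapping"
    "HOL-Algebra.Bij"
    "HOL-Algebra.Ideal"
begin

text \<open>
  A monomial in variables of type \<open>'v\<close> is its exponent vector, a finitely supported map
  \<open>'v \<Rightarrow>\<^sub>0 nat\<close>; a polynomial is a finitely supported map from monomials to coefficients.
  The ring operations, with convolution as product, are those of \<^theory>\<open>HOL-Library.Poly_Mapping\<close>.
\<close>

type_synonym 'v monom = "'v \<Rightarrow>\<^sub>0 nat"
type_synonym ('v, 'a) mpoly = "'v monom \<Rightarrow>\<^sub>0 'a"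

definition mvar :: "'v \<Rightarrow> ('v, 'a::zero_neq_one) mpoly" where
  "mvar v = Poly_Mapping.single (Poly_Mapping.single v 1) 1"

definition mconst :: "'a::zero \<Rightarrow> ('v, 'a) mpoly" where
  "mconst c = Poly_Mapping.single 0 c"

definition monom_degree :: "'v monom \<Rightarrow> nat" where
  "monom_degree m = (\<Sum>v\<in>Poly_Mapping.keys m. Poly_Mapping.lookup m v)"

text \<open>The zero polynomial is given degree 0.\<close>

definition total_degree :: "('v, 'a::zero) mpoly \<Rightarrow> nat" where
  "total_degree p = Max (insert 0 (monom_degree ` Poly_Mapping.keys p))"

text \<open>
  The ring homomorphism that acts on coefficients by \<open>\<phi>\<close> and sends each variable \<open>v\<close> to \<open>a v\<close>.
\<close>

definition mpoly_subst ::
  "('a::zero \<Rightarrow> 'b::comm_semiring_1) \<Rightarrow> ('v \<Rightarrow> 'b) \<Rightarrow> ('v, 'a) mpoly \<Rightarrow> 'b" where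
  "mpoly_subst \<phi> a p =
     (\<Sum>m\<in>Poly_Mapping.keys p. \<phi> (Poly_Mapping.lookup p m) *
        (\<Prod>v\<in>Poly_Mapping.keys m. a v ^ Poly_Mapping.lookup m v))"

definition mpoly_ring :: "'v set \<Rightarrow> ('v, 'a::comm_ring_1) mpoly ring" where
  "mpoly_ring V =
     \<lparr>carrier = {p. \<forall>m\<in>Poly_Mapping.keys p. Poly_Mapping.keys m \<subseteq> V},
      mult = (*), one = 1, zero = 0, add = (+)\<rparr>"

text \<open>Here \<open>lt\<close> is the strict term order.\<close>

definition lead_monom :: "('v monom \<Rightarrow> 'v monom \<Rightarrow> bool) \<Rightarrow> ('v, 'a::zero) mpoly \<Rightarrow> 'v monom" where
  "lead_monom lt p =
     (THE m. m \<in> Poly_Mapping.keys p \<and> (\<forall>m'\<in>Poly_Mapping.keys p. m' \<noteq> m \<longrightarrow> lt m' m))"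

definition initial_ideal ::
  "'v set \<Rightarrow> ('v monom \<Rightarrow> 'v monom \<Rightarrow> bool) \<Rightarrow> ('v, 'a::comm_ring_1) mpoly set \<Rightarrow> ('v, 'a) mpoly set"
  where
  "initial_ideal V lt S =
     Idl\<^bsub>mpoly_ring V\<^esub> ((\<lambda>p. Poly_Mapping.single (lead_monom lt p) 1) ` (S - {0}))"

definition is_groebner_basis ::
  "'v set \<Rightarrow> ('v monom \<Rightarrow> 'v monom \<Rightarrow> bool) \<Rightarrow> ('v, 'a::comm_ring_1) mpoly set \<Rightarrow> ('v, 'a) mpoly set \<Rightarrow> bool"
  where
  "is_groebner_basis V lt I G \<longleftrightarrow>
     finite G \<and> G \<subseteq> I \<and> initial_ideal V lt G = initial_ideal V lt I"

text \<open>
  Here \<open>(u, v) \<in> r\<close> means that the variable \<open>u\<close> is smaller than or equal to \<open>v\<close>. Among monomials of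
  equal degree, the one with the larger exponent at the smallest variable where they differ is the
  smaller monomial.
\<close>

definition grevlex_less :: "'v rel \<Rightarrow> 'v monom \<Rightarrow> 'v monom \<Rightarrow> bool" where
  "grevlex_less r a b \<longleftrightarrow>
     monom_degree a < monom_degree b \<or>
     monom_degree a = monom_degree b \<and>
     (\<exists>v\<in>Field r. Poly_Mapping.lookup a v > Poly_Mapping.lookup b v \<and>
        (\<forall>u. (u, v) \<in> r \<and> u \<noteq> v \<longrightarrow> Poly_Mapping.lookup a u = Poly_Mapping.lookup b u))"

text \<open>
  The matrix that sends the basis vector \<open>e\<^sub>k\<close> to \<open>e\<close> with index \<open>\<sigma> k\<close>. It is polymorphic in the
  entries: they are real for the convex hull, integers for summability, exponents for the toric map.
\<close>

definition perm_matrix :: "('n \<Rightarrow> 'n) \<Rightarrow> 'a::zero_neq_one ^ 'n ^ 'n" where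
  "perm_matrix \<sigma> = (\<chi> j k. if j = \<sigma> k then 1 else 0)"

text \<open>
  Finite families with repetitions are lists; the empty list has sum 0.
\<close>

definition permutation_summable :: "('n::finite \<Rightarrow> 'n) set \<Rightarrow> bool" where
  "permutation_summable A \<longleftrightarrow>
     (\<forall>ps. set ps \<subseteq> A \<longrightarrow>
        (\<forall>j k. ((\<Sum>p\<leftarrow>ps. perm_matrix p) - mat 1 :: int ^ 'n ^ 'n) $ j $ k \<ge> 0) \<longrightarrow>
        (\<exists>qs. set qs \<subseteq> A \<and>
           (\<Sum>p\<leftarrow>ps. perm_matrix p) - mat 1 = (\<Sum>q\<leftarrow>qs. perm_matrix q :: int ^ 'n ^ 'n)))"

definition toric_map ::
  "('n::finite \<Rightarrow> 'n, complex) mpoly \<Rightarrow> ('n \<times> 'n, complex) mpoly" where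
  "toric_map =
     mpoly_subst mconst
       (\<lambda>\<sigma>. \<Prod>j\<in>UNIV. \<Prod>k\<in>UNIV. mvar (j, k) ^ ((perm_matrix \<sigma> :: nat ^ 'n ^ 'n) $ j $ k))"

definition toric_ideal :: "('n::finite \<Rightarrow> 'n) set \<Rightarrow> ('n \<Rightarrow> 'n, complex) mpoly set" where
  "toric_ideal A = a_kernel (mpoly_ring A) (mpoly_ring UNIV) toric_map"

definition eval_matrix :: "('n \<times> 'n, real) mpoly \<Rightarrow> real ^ 'n ^ 'n \<Rightarrow> real" where
  "eval_matrix f x = mpoly_subst (\<lambda>c. c) (\<lambda>(i, j). x $ i $ j) f"

definition vanishing_ideal :: "(real ^ 'n ^ 'n) set \<Rightarrow> ('n \<times> 'n, real) mpoly set" where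
  "vanishing_ideal X = {f. \<forall>x\<in>X. eval_matrix f x = 0}"

definition sos_mod :: "nat \<Rightarrow> ('v, real) mpoly set \<Rightarrow> ('v, real) mpoly \<Rightarrow> bool" where
  "sos_mod k I f \<longleftrightarrow> (\<exists>hs. (\<forall>h\<in>set hs. total_degree h \<le> k) \<and> f - (\<Sum>h\<leftarrow>hs. h ^ 2) \<in> I)"

definition theta_body :: "nat \<Rightarrow> ('n \<times> 'n, real) mpoly set \<Rightarrow> (real ^ 'n ^ 'n) set" where
  "theta_body k I = {x. \<forall>f. total_degree f \<le> 1 \<longrightarrow> sos_mod k I f \<longrightarrow> eval_matrix f x \<ge> 0}"

definition theta_exact :: "('n::finite \<Rightarrow> 'n) set \<Rightarrow> bool" where
  "theta_exact A \<longleftrightarrow>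
     convex hull (perm_matrix ` A) = theta_body 1 (vanishing_ideal (perm_matrix ` A))"

end

(*
  Both hypotheses are used only through one closure property of the monoid M of sums of elements
  of A: if v is in M and some multiple N v can be written as a sum involving s, then so can v
  itself. For a summable A this holds because N v >= P_s entrywise forces v >= P_s. For quadratic
  Groebner bases take a reverse lexicographic order whose smallest variable is x_s, and let x^m be
  the least monomial in the fibre of v. If x_s does not divide x^m, then x^(N m) is not minimal in
  its fibre, hence is divisible by the leading monomial of some quadric of the basis. That leading
  monomial is squarefree, because x_p^2 is alone in its fibre, so it already divides x^m,
  contradicting minimality.

  The closure property makes conv(A) two-level: if F is a facet with slack function g, and s, t in A
  lie off F, then P_t is an affine combination of P_s and the vertices of F. Dirichlet approximation
  turns this into an exact integer relation p P_t = q P_s + sum_f n_f P_f with p, q > 0. Hence a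
  multiple of P_t + B sum_f P_f, for large B, involves s, so this sum itself does, and g(t) >= g(s).
  A slack function with values in {0, 1} on A satisfies g = g^2 modulo the vanishing ideal, so it is
  nonnegative on the first theta body.
*)

theory Submission
  imports Defs
begin

section \<open>Substitution in polynomials\<close>

text \<open>The inner product of \<open>mpoly_subst\<close>, named so that its multiplicativity can
  be stated.\<close>

definition monom_eval :: "('v \<Rightarrow> 'b::comm_semiring_1) \<Rightarrow> 'v monom \<Rightarrow> 'b" where
  "monom_eval a m = (\<Prod>v\<in>Poly_Mapping.keys m. a v ^ Poly_Mapping.lookup m v)"

lemma monom_eval_superset:
  assumes "finite V" "Poly_Mapping.keys m \<subseteq> V"
  shows "monom_eval a m = (\<Prod>v\<in>V. a v ^ Poly_Mapping.lookup m v)"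
  unfolding monom_eval_def
  by (rule prod.mono_neutral_left) (use assms in \<open>auto simp: in_keys_iff\<close>)

lemma monom_eval_0 [simp]: "monom_eval a 0 = 1"
  by (simp add: monom_eval_def)

lemma monom_eval_single: "monom_eval a (Poly_Mapping.single v n) = a v ^ n"
  by (cases "n = 0") (simp_all add: monom_eval_def)

lemma monom_eval_add: "monom_eval a (m + n) = monom_eval a m * monom_eval a n"
proof -
  let ?V = "Poly_Mapping.keys m \<union> Poly_Mapping.keys n"
  have V: "finite ?V" "Poly_Mapping.keys (m + n) \<subseteq> ?V"
    using keys_add[of m n] by auto
  show ?thesis
    by (simp add: monom_eval_superset[of ?V] V lookup_add power_add prod.distrib)
qed

text \<open>Enlarging the support only adds zero terms. This lets polynomials with different
  supports be summed over one index set.\<close>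

lemma mpoly_subst_superset:
  assumes "finite S" "Poly_Mapping.keys p \<subseteq> S" "\<phi> 0 = 0"
  shows "mpoly_subst \<phi> a p = (\<Sum>m\<in>S. \<phi> (Poly_Mapping.lookup p m) * monom_eval a m)"
  unfolding mpoly_subst_def monom_eval_def
  by (rule sum.mono_neutral_left) (use assms in \<open>auto simp: in_keys_iff\<close>)

lemma mpoly_subst_0 [simp]: "mpoly_subst \<phi> a 0 = 0"
  by (simp add: mpoly_subst_def)

lemma mpoly_subst_single:
  assumes "\<phi> 0 = 0"
  shows "mpoly_subst \<phi> a (Poly_Mapping.single m c) = \<phi> c * monom_eval a m"
  using assms by (cases "c = 0") (simp_all add: mpoly_subst_def monom_eval_def)

lemma mpoly_subst_add:
  assumes "\<phi> 0 = 0" "\<And>x y. \<phi> (x + y) = \<phi> x + \<phi> y"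
  shows "mpoly_subst \<phi> a (p + q) = mpoly_subst \<phi> a p + mpoly_subst \<phi> a q"
proof -
  let ?S = "Poly_Mapping.keys p \<union> Poly_Mapping.keys q"
  have S: "finite ?S" "Poly_Mapping.keys (p + q) \<subseteq> ?S"
    using keys_add[of p q] by auto
  show ?thesis
    by (simp add: mpoly_subst_superset[of ?S] S assms lookup_add distrib_right sum.distrib)
qed

lemma mpoly_subst_sum:
  assumes "\<phi> 0 = 0" "\<And>x y. \<phi> (x + y) = \<phi> x + \<phi> y"
  shows "mpoly_subst \<phi> a (\<Sum>i\<in>I. p i) = (\<Sum>i\<in>I. mpoly_subst \<phi> a (p i))"
  by (induction I rule: infinite_finite_induct) (simp_all add: mpoly_subst_add assms)

lemma mpoly_eq_sum_single:
  "p = (\<Sum>m\<in>Poly_Mapping.keys p. Poly_Mapping.single m (Poly_Mapping.lookup p m))"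
proof (rule poly_mapping_eqI)
  fix k
  show "Poly_Mapping.lookup p k = Poly_Mapping.lookup
    (\<Sum>m\<in>Poly_Mapping.keys p. Poly_Mapping.single m (Poly_Mapping.lookup p m)) k"
    by (cases "k \<in> Poly_Mapping.keys p")
       (auto simp: lookup_sum lookup_single when_def sum.delta in_keys_iff)
qed

text \<open>Expanding both factors into single terms reduces the claim to
  \<open>monom_eval_add\<close>.\<close>

lemma mpoly_subst_mult:
  assumes "\<phi> 0 = 0" "\<And>x y. \<phi> (x + y) = \<phi> x + \<phi> y" "\<And>x y. \<phi> (x * y) = \<phi> x * \<phi> y"
  shows "mpoly_subst \<phi> a (p * q) = mpoly_subst \<phi> a p * mpoly_subst \<phi> a q"
proof -
  let ?P = "Poly_Mapping.keys p" and ?Q = "Poly_Mapping.keys q"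
  let ?s = "\<lambda>r m. Poly_Mapping.single m (Poly_Mapping.lookup r m)"
  have "p * q = (\<Sum>m\<in>?P. ?s p m) * (\<Sum>n\<in>?Q. ?s q n)"
    by (rule arg_cong2[OF mpoly_eq_sum_single mpoly_eq_sum_single])
  also have "\<dots> = (\<Sum>m\<in>?P. \<Sum>n\<in>?Q. ?s p m * ?s q n)"
    by (simp add: sum_product)
  finally have "mpoly_subst \<phi> a (p * q) = (\<Sum>m\<in>?P. \<Sum>n\<in>?Q. mpoly_subst \<phi> a (?s p m * ?s q n))"
    by (simp add: mpoly_subst_sum assms(1,2))
  also have "\<dots> = (\<Sum>m\<in>?P. \<Sum>n\<in>?Q. mpoly_subst \<phi> a (?s p m) * mpoly_subst \<phi> a (?s q n))"
    by (intro sum.cong refl)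
       (simp add: mult_single mpoly_subst_single assms monom_eval_add mult_ac)
  also have "\<dots> = mpoly_subst \<phi> a (\<Sum>m\<in>?P. ?s p m) * mpoly_subst \<phi> a (\<Sum>n\<in>?Q. ?s q n)"
    by (simp add: mpoly_subst_sum assms(1,2) sum_product)
  finally show ?thesis
    by (simp flip: mpoly_eq_sum_single)
qed

section \<open>Evaluation of polynomials at matrices\<close>

lemma eval_matrix_add: "eval_matrix (p + q) x = eval_matrix p x + eval_matrix q x"
  by (simp add: eval_matrix_def mpoly_subst_add)

lemma eval_matrix_mult: "eval_matrix (p * q) x = eval_matrix p x * eval_matrix q x"
  by (simp add: eval_matrix_def mpoly_subst_mult)

lemma eval_matrix_0 [simp]: "eval_matrix 0 x = 0"
  by (simp add: eval_matrix_def)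

lemma eval_matrix_minus: "eval_matrix (- p) x = - eval_matrix p x"
  using eval_matrix_add[of p "- p" x] by simp

lemma eval_matrix_diff: "eval_matrix (p - q) x = eval_matrix p x - eval_matrix q x"
  using eval_matrix_add[of p "- q" x] by (simp add: eval_matrix_minus)

lemma eval_matrix_sum_list_squares:
  "eval_matrix (\<Sum>h\<leftarrow>hs. h\<^sup>2) x = (\<Sum>h\<leftarrow>hs. (eval_matrix h x)\<^sup>2)"
  by (induction hs) (simp_all add: eval_matrix_add eval_matrix_mult power2_eq_square)

section \<open>Degrees of monomials and affine polynomials\<close>

lemma monom_degree_superset:
  assumes "finite V" "Poly_Mapping.keys m \<subseteq> V"
  shows "monom_degree m = (\<Sum>v\<in>V. Poly_Mapping.lookup m v)"
  unfolding monom_degree_def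
  by (rule sum.mono_neutral_left) (use assms in \<open>auto simp: in_keys_iff\<close>)

lemma monom_degree_add: "monom_degree (m + n) = monom_degree m + monom_degree n"
proof -
  let ?V = "Poly_Mapping.keys m \<union> Poly_Mapping.keys n"
  have V: "finite ?V" "Poly_Mapping.keys (m + n) \<subseteq> ?V"
    using keys_add[of m n] by auto
  show ?thesis
    by (simp add: monom_degree_superset[of ?V] V lookup_add sum.distrib)
qed

lemma monom_degree_0 [simp]: "monom_degree 0 = 0"
  by (simp add: monom_degree_def)

lemma monom_degree_single [simp]: "monom_degree (Poly_Mapping.single v n) = n"
  by (cases "n = 0") (simp_all add: monom_degree_def)

lemma monom_add_single_remove:
  assumes "v \<in> Poly_Mapping.keys m"
  shows "\<exists>n. m = Poly_Mapping.single v (1::nat) + n"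
proof -
  have "m = Poly_Mapping.single v 1 + (m - Poly_Mapping.single v 1)"
  proof (rule poly_mapping_eqI)
    fix k
    have "Poly_Mapping.lookup m v \<noteq> 0"
      using assms by (simp add: in_keys_iff)
    then show "Poly_Mapping.lookup m k =
        Poly_Mapping.lookup (Poly_Mapping.single v 1 + (m - Poly_Mapping.single v 1)) k"
      by (cases "v = k") (simp_all add: lookup_add lookup_minus lookup_single)
  qed
  then show ?thesis ..
qed

lemma monom_degree_eq_0_iff: "monom_degree m = 0 \<longleftrightarrow> m = 0"
proof
  assume "monom_degree m = 0"
  then have "v \<notin> Poly_Mapping.keys m" for v
    by (auto simp: monom_degree_def in_keys_iff)
  then have "Poly_Mapping.keys m = {}"
    by blast
  then show "m = 0"
    by (rule iffD1[OF keys_eq_empty])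
qed simp

lemma monom_degree_eq_1E:
  assumes "monom_degree m = 1"
  obtains v where "m = Poly_Mapping.single v 1"
proof -
  have "m \<noteq> 0"
    using assms by (metis monom_degree_0 zero_neq_one)
  then obtain v where "v \<in> Poly_Mapping.keys m"
    by (metis keys_eq_empty all_not_in_conv)
  from monom_add_single_remove[OF this] obtain n where n: "m = Poly_Mapping.single v 1 + n"
    by (rule exE)
  have "monom_degree n = 0"
    using assms unfolding n monom_degree_add by simp
  then have "m = Poly_Mapping.single v 1"
    by (simp only: n monom_degree_eq_0_iff add_0_right)
  then show thesis
    by (rule that)
qed

lemma total_degree_le_iff:
  "total_degree p \<le> d \<longleftrightarrow> (\<forall>m\<in>Poly_Mapping.keys p. monom_degree m \<le> d)"
  by (simp add: total_degree_def)

text \<open>A monomial of degree at most one is 1 or a single variable. The variables respect every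
  linear combination, the monomial 1 those with \<open>u + v = 1\<close>.\<close>

lemma eval_matrix_affine:
  assumes "total_degree f \<le> 1" "u + v = 1"
  shows "eval_matrix f (u *\<^sub>R x + v *\<^sub>R y) = u * eval_matrix f x + v * eval_matrix f y"
proof -
  let ?e = "\<lambda>x::real^'a^'a. monom_eval (\<lambda>(i, j). x $ i $ j)"
  have "?e (u *\<^sub>R x + v *\<^sub>R y) m = u * ?e x m + v * ?e y m" if "m \<in> Poly_Mapping.keys f" for m
  proof -
    have "monom_degree m = 0 \<or> monom_degree m = 1"
      using assms(1) that by (force simp: total_degree_le_iff)
    then show ?thesis
    proof
      assume "monom_degree m = 0"
      with assms(2) show ?thesis
        by (simp add: monom_degree_eq_0_iff)
    next
      assume "monom_degree m = 1"
      then obtain v where "m = Poly_Mapping.single v 1"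
        by (rule monom_degree_eq_1E)
      then show ?thesis
        by (cases v) (simp add: monom_eval_single)
    qed
  qed
  then have "(\<Sum>m\<in>Poly_Mapping.keys f. Poly_Mapping.lookup f m * ?e (u *\<^sub>R x + v *\<^sub>R y) m)
      = (\<Sum>m\<in>Poly_Mapping.keys f. u * (Poly_Mapping.lookup f m * ?e x m)
          + v * (Poly_Mapping.lookup f m * ?e y m))"
    by (intro sum.cong) (simp_all add: algebra_simps)
  then show ?thesis
    by (simp add: eval_matrix_def mpoly_subst_def sum.distrib sum_distrib_left flip: monom_eval_def)
qed

definition affine_mpoly :: "real ^ 'n ^ 'n \<Rightarrow> real \<Rightarrow> ('n::finite \<times> 'n, real) mpoly" where
  "affine_mpoly a c = Poly_Mapping.single 0 c +
     (\<Sum>v\<in>UNIV. Poly_Mapping.single (Poly_Mapping.single v 1) (a $ fst v $ snd v))"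

lemma eval_affine_mpoly: "eval_matrix (affine_mpoly a c) x = a \<bullet> x + c"
proof -
  have "(\<Sum>v\<in>UNIV. a $ fst v $ snd v * x $ fst v $ snd v) = a \<bullet> x"
    by (simp add: inner_vec_def sum.cartesian_product UNIV_Times_UNIV case_prod_beta)
  then show ?thesis
    by (simp add: affine_mpoly_def eval_matrix_def mpoly_subst_add mpoly_subst_sum
        mpoly_subst_single monom_eval_single case_prod_beta)
qed

lemma total_degree_affine_mpoly: "total_degree (affine_mpoly a c) \<le> 1"
  unfolding total_degree_le_iff
proof
  fix m
  assume "m \<in> Poly_Mapping.keys (affine_mpoly a c)"
  then have "m \<in> Poly_Mapping.keys (Poly_Mapping.single 0 c) \<union> Poly_Mapping.keys
      (\<Sum>v\<in>UNIV. Poly_Mapping.single (Poly_Mapping.single v 1) (a $ fst v $ snd v))"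
    unfolding affine_mpoly_def by (rule subsetD[OF keys_add])
  then show "monom_degree m \<le> 1"
  proof
    assume "m \<in> Poly_Mapping.keys (Poly_Mapping.single 0 c)"
    then show ?thesis
      by (simp split: if_splits)
  next
    assume "m \<in> Poly_Mapping.keys
      (\<Sum>v\<in>UNIV. Poly_Mapping.single (Poly_Mapping.single v 1) (a $ fst v $ snd v))"
    from subsetD[OF keys_sum this] obtain v where
      "m \<in> Poly_Mapping.keys (Poly_Mapping.single (Poly_Mapping.single v 1) (a $ fst v $ snd v))"
      by blast
    then show ?thesis
      by (simp split: if_splits)
  qed
qed

section \<open>Two-valued facets and exactness\<close>

text \<open>A polynomial that is 1-sos modulo the vanishing ideal equals a sum of squares on
  \<open>X\<close>. Since it is affine, its nonnegativity extends to the hull.\<close>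

lemma convex_hull_subset_theta_body:
  fixes X :: "(real ^ 'n::finite ^ 'n) set"
  shows "convex hull X \<subseteq> theta_body 1 (vanishing_ideal X)"
proof
  fix x
  assume x: "x \<in> convex hull X"
  have "eval_matrix f x \<ge> 0"
    if f: "total_degree f \<le> 1" "sos_mod 1 (vanishing_ideal X) f" for f
  proof -
    obtain hs where "f - (\<Sum>h\<leftarrow>hs. h\<^sup>2) \<in> vanishing_ideal X"
      using f(2) by (auto simp: sos_mod_def)
    then have "eval_matrix f y = (\<Sum>h\<leftarrow>hs. (eval_matrix h y)\<^sup>2)" if "y \<in> X" for y
      using that by (auto simp: vanishing_ideal_def eval_matrix_diff eval_matrix_sum_list_squares)
    then have "X \<subseteq> {y. eval_matrix f y \<ge> 0}"
      by (auto intro!: sum_list_nonneg)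
    moreover have "convex {y::real^'n^'n. eval_matrix f y \<ge> 0}"
      by (auto simp: convex_def eval_matrix_affine[OF f(1)])
    ultimately show ?thesis
      using x hull_minimal by blast
  qed
  then show "x \<in> theta_body 1 (vanishing_ideal X)"
    by (simp add: theta_body_def)
qed

text \<open>For \<open>s > 0\<close> the rescaled function \<open>f\<close> is 0 or 1 on
  \<open>X\<close>, so \<open>f\<close> and its square agree there and \<open>f\<close> is its own
  certificate. For \<open>s = 0\<close> the function vanishes on \<open>X\<close> and the empty sum
  of squares suffices.\<close>

lemma theta_body_affine_nonneg:
  fixes X :: "(real ^ 'n::finite ^ 'n) set"
  assumes "x \<in> theta_body 1 (vanishing_ideal X)"
    and "\<And>y. y \<in> X \<Longrightarrow> a \<bullet> y + c = 0 \<or> a \<bullet> y + c = s" "s \<ge> 0"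
  shows "a \<bullet> x + c \<ge> 0"
proof (cases "s = 0")
  case True
  then have "sos_mod 1 (vanishing_ideal X) (affine_mpoly a c)"
    using assms(2) by (auto simp: sos_mod_def vanishing_ideal_def eval_affine_mpoly intro!: exI[of _ "[]"])
  then show ?thesis
    using assms(1) total_degree_affine_mpoly[of a c] eval_affine_mpoly[of a c x]
    unfolding theta_body_def by fastforce
next
  case False
  with assms(3) have s: "s > 0"
    by simp
  define f where "f = affine_mpoly (a /\<^sub>R s) (c / s)"
  have ev: "eval_matrix f y = (a \<bullet> y + c) / s" for y
    by (simp add: f_def eval_affine_mpoly divide_simps)
  have "sos_mod 1 (vanishing_ideal X) f"
    unfolding sos_mod_def
  proof (intro exI[of _ "[f]"] conjI)
    show "\<forall>h\<in>set [f]. total_degree h \<le> 1"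
      using total_degree_affine_mpoly by (auto simp: f_def)
    have "eval_matrix f y = 0 \<or> eval_matrix f y = 1" if "y \<in> X" for y
      using assms(2)[OF that] s by (auto simp: ev)
    then show "f - (\<Sum>h\<leftarrow>[f]. h\<^sup>2) \<in> vanishing_ideal X"
      by (fastforce simp: vanishing_ideal_def eval_matrix_diff eval_matrix_mult power2_eq_square)
  qed
  then have "eval_matrix f x \<ge> 0"
    using assms(1) total_degree_affine_mpoly unfolding theta_body_def f_def by blast
  then show ?thesis
    using s by (simp add: ev zero_le_divide_iff)
qed

text \<open>The equation of a hyperplane through \<open>X\<close> vanishes on \<open>X\<close>, so
  the case \<open>s = 0\<close> above applies to it with either sign.\<close>

lemma theta_body_subset_affine_hull:
  fixes X :: "(real ^ 'n::finite ^ 'n) set"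
  shows "theta_body 1 (vanishing_ideal X) \<subseteq> affine hull X"
proof
  fix x
  assume x: "x \<in> theta_body 1 (vanishing_ideal X)"
  obtain \<F> where F: "affine hull X = \<Inter>\<F>" "\<And>h. h \<in> \<F> \<Longrightarrow> \<exists>a b. a \<noteq> 0 \<and> h = {x. a \<bullet> x = b}"
    using affine_hull_finite_intersection_hyperplanes[of X] by metis
  have "x \<in> h" if h: "h \<in> \<F>" for h
  proof -
    obtain a b where ab: "h = {x. a \<bullet> x = b}"
      using F(2) h by blast
    have "X \<subseteq> h"
      using F(1) h hull_subset[of X affine] by blast
    then have "a \<bullet> y = b" if "y \<in> X" for y
      using ab that by blast
    then have "a \<bullet> x + - b \<ge> 0" "- a \<bullet> x + b \<ge> 0"
      using theta_body_affine_nonneg[OF x, of a "- b" 0]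
        theta_body_affine_nonneg[OF x, of "- a" b 0] by simp_all
    then show ?thesis
      by (simp add: ab)
  qed
  then show "x \<in> affine hull X"
    using F(1) by blast
qed

text \<open>The polytope is cut out of its affine hull by an irredundant family of half-spaces, each
  of which defines a facet. It remains to bound the theta body by each of them.\<close>

lemma convex_hull_eq_theta_body:
  fixes X :: "(real ^ 'n::finite ^ 'n) set"
  assumes "finite X"
    and facets: "\<And>a b. convex hull X \<inter> {x. a \<bullet> x = b} facet_of convex hull X \<Longrightarrow>
      (\<And>y. y \<in> X \<Longrightarrow> a \<bullet> y \<le> b) \<Longrightarrow> \<exists>s. \<forall>y\<in>X. a \<bullet> y = b \<or> a \<bullet> y = s"
  shows "convex hull X = theta_body 1 (vanishing_ideal X)"
proof
  show "convex hull X \<subseteq> theta_body 1 (vanishing_ideal X)"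
    by (rule convex_hull_subset_theta_body)
  show "theta_body 1 (vanishing_ideal X) \<subseteq> convex hull X"
  proof
    fix x
    assume x: "x \<in> theta_body 1 (vanishing_ideal X)"
    have "polyhedron (convex hull X)"
      using assms(1) polyhedron_convex_hull by blast
    then obtain F where F: "finite F" "convex hull X = affine hull (convex hull X) \<inter> \<Inter>F"
      "\<forall>h\<in>F. \<exists>a b. a \<noteq> 0 \<and> h = {x. a \<bullet> x \<le> b}"
      "\<forall>F'. F' \<subset> F \<longrightarrow> convex hull X \<subset> affine hull (convex hull X) \<inter> \<Inter>F'"
      unfolding polyhedron_Int_affine_minimal by meson
    from F(3) obtain a b where ab: "\<And>h. h \<in> F \<Longrightarrow> a h \<noteq> 0 \<and> h = {x. a h \<bullet> x \<le> b h}"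
      by metis
    have "x \<in> h" if h: "h \<in> F" for h
    proof -
      have facet: "convex hull X \<inter> {x. a h \<bullet> x = b h} facet_of convex hull X"
        using facet_of_polyhedron_explicit[OF F(1,2) ab] F(4) h by blast
      have le: "a h \<bullet> y \<le> b h" if "y \<in> X" for y
      proof -
        have "y \<in> h"
          using F(2) h that hull_inc[of y X convex] by blast
        then show ?thesis
          using ab[OF h] by blast
      qed
      obtain s where s: "\<forall>y\<in>X. a h \<bullet> y = b h \<or> a h \<bullet> y = s"
        using facets[OF facet le] by blast
      \<comment> \<open>On \<open>X\<close> the slack takes the values 0 and \<open>b h - s\<close>.
        The maximum ensures nonnegativity without exhibiting a point of \<open>X\<close> off the
        facet.\<close>
      have "- a h \<bullet> x + b h \<ge> 0"
        by (rule theta_body_affine_nonneg[OF x, where s = "max 0 (b h - s)"])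
           (use s le in force)+
      then show ?thesis
        using ab[OF h] by fastforce
    qed
    moreover have "x \<in> affine hull (convex hull X)"
      using theta_body_subset_affine_hull x by auto
    ultimately show "x \<in> convex hull X"
      using F(2) by blast
  qed
qed

section \<open>Saturated sums of permutation matrices\<close>

text \<open>
  Sums of permutation matrices are given by multiplicities \<open>c\<close>, and \<open>entry_sum A c j k\<close> is the entry
  in row \<open>j\<close> and column \<open>k\<close> of the sum. That \<open>\<sigma>\<close> can be subtracted from a sum is expressed
  without subtraction, by multiplicities of the same sum that are positive at \<open>\<sigma>\<close>.
\<close>

definition entry_sum :: "('n \<Rightarrow> 'n) set \<Rightarrow> (('n \<Rightarrow> 'n) \<Rightarrow> 'a::comm_monoid_add) \<Rightarrow> 'n \<Rightarrow> 'n \<Rightarrow> 'a" where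
  "entry_sum A c j k = (\<Sum>p\<in>A. if j = p k then c p else 0)"

definition sum_saturated :: "('n \<Rightarrow> 'n) set \<Rightarrow> bool" where
  "sum_saturated A \<longleftrightarrow>
     (\<forall>\<sigma>\<in>A. \<forall>(c :: _ \<Rightarrow> nat) c' N. c' \<sigma> > 0 \<longrightarrow>
        (\<forall>j k. N * entry_sum A c j k = entry_sum A c' j k) \<longrightarrow>
        (\<exists>d. d \<sigma> > 0 \<and> entry_sum A d = entry_sum A c))"

text \<open>Each column of a matrix \<open>P_p\<close> contains exactly one 1, so any column sum
  counts the summands with multiplicity.\<close>

lemma sum_entry_sum:
  fixes A :: "('n::finite \<Rightarrow> 'n) set"
  shows "(\<Sum>j\<in>UNIV. entry_sum A c j k) = (\<Sum>p\<in>A. c p)"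
  unfolding entry_sum_def by (subst sum.swap) simp

lemma of_nat_entry_sum: "of_nat (entry_sum A c j k) = entry_sum A (\<lambda>p. of_nat (c p)) j k"
  by (simp add: entry_sum_def if_distrib[of of_nat] cong: if_cong)

lemma sum_scaleR_perm_matrix:
  fixes A :: "('n::finite \<Rightarrow> 'n) set"
  shows "(\<Sum>p\<in>A. w p *\<^sub>R perm_matrix p :: real ^ 'n ^ 'n) $ j $ k = entry_sum A w j k"
  by (auto simp: entry_sum_def perm_matrix_def intro!: sum.cong)

lemma inj_perm_matrix: "inj (perm_matrix :: ('n::finite \<Rightarrow> 'n) \<Rightarrow> 'a::zero_neq_one ^ 'n ^ 'n)"
proof
  fix p q :: "'n \<Rightarrow> 'n"
  assume "(perm_matrix p :: 'a ^ 'n ^ 'n) = perm_matrix q"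
  then have "(perm_matrix p :: 'a ^ 'n ^ 'n) $ p k $ k = perm_matrix q $ p k $ k" for k
    by simp
  then have "(if p k = q k then 1 else 0) = (1 :: 'a)" for k
    by (simp add: perm_matrix_def)
  then have "p k = q k" for k
    by (metis zero_neq_one)
  then show "p = q"
    by blast
qed

text \<open>Simultaneous approximation with one common denominator, transported to \<open>S\<close>
  by an enumeration.\<close>

lemma Dirichlet_approx_finite:
  fixes w :: "'a \<Rightarrow> real"
  assumes "finite S" "N > 0"
  obtains q :: int and m :: "'a \<Rightarrow> int"
  where "q > 0" "\<And>p. p \<in> S \<Longrightarrow> \<bar>of_int q * w p - of_int (m p)\<bar> < 1 / real N"
proof -
  obtain h where h: "bij_betw h {0..<card S} S"
    using ex_bij_betw_nat_finite[OF assms(1)] by blast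
  obtain q m where q: "0 < q" "q \<le> int (N ^ card S)"
    and m: "\<And>i. i < card S \<Longrightarrow> \<bar>of_int q * w (h i) - of_int (m i)\<bar> < 1 / real N"
    using Dirichlet_approx_simult[OF assms(2), of "card S" "\<lambda>i. w (h i)"] by blast
  let ?g = "the_inv_into {0..<card S} h"
  have "\<bar>of_int q * w p - of_int (m (?g p))\<bar> < 1 / real N" if "p \<in> S" for p
  proof -
    have "h (?g p) = p"
      using h that by (simp add: f_the_inv_into_f_bij_betw)
    moreover have "?g p \<in> {0..<card S}"
      using h that by (metis bij_betwE bij_betw_the_inv_into)
    ultimately show ?thesis
      using m[of "?g p"] by simp
  qed
  with q(1) show thesis
    by (rule that)
qed

text \<open>The facet is the hull of the points of \<open>X\<close> on it, and its dimension is one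
  below that of the polytope. A point off its hyperplane raises the dimension by one, so the affine
  hulls coincide.\<close>

lemma facet_of_convex_hull_affine_span:
  fixes X :: "'a::euclidean_space set"
  assumes "finite X" and facet: "convex hull X \<inter> {x. a \<bullet> x = b} facet_of convex hull X"
    and v: "v \<in> X" "a \<bullet> v \<noteq> b"
  shows "X \<subseteq> affine hull (insert v {x \<in> X. a \<bullet> x = b})"
proof -
  let ?C = "convex hull X \<inter> {x. a \<bullet> x = b}" and ?Y = "{x \<in> X. a \<bullet> x = b}"
  have "compact X"
    using assms(1) by (rule finite_imp_compact)
  then obtain S where S: "S \<subseteq> X" "?C = convex hull S"
    using facet face_of_convex_hull_subset unfolding facet_of_def by metis
  have "S \<subseteq> ?C"
    unfolding S(2) by (rule hull_subset)
  with S(1) have "S \<subseteq> ?Y"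
    by blast
  then have "?C \<subseteq> convex hull ?Y"
    unfolding S(2) by (rule hull_mono)
  also have "\<dots> \<subseteq> affine hull (insert v ?Y)"
    using convex_hull_subset_affine_hull hull_mono[of ?Y "insert v ?Y" affine] by blast
  finally have "insert v ?C \<subseteq> affine hull (insert v ?Y)"
    using hull_inc[of v "insert v ?Y" affine] by blast
  then have sub: "affine hull (insert v ?C) \<subseteq> affine hull (insert v ?Y)"
    by (simp add: hull_minimal affine_affine_hull)
  have "affine hull ?C \<subseteq> {x. a \<bullet> x = b}"
    by (intro hull_minimal affine_hyperplane) blast
  then have "v \<notin> affine hull ?C"
    using v(2) by blast
  then have dim: "aff_dim (insert v ?C) = aff_dim (convex hull X)"
    using facet by (simp add: aff_dim_insert facet_of_def)
  have "insert v ?C \<subseteq> convex hull X"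
    using v(1) hull_inc[of v X convex] by blast
  then have "affine hull (insert v ?C) = affine hull (convex hull X)"
    using aff_dim_eq_full_gen dim by blast
  then show ?thesis
    using sub hull_subset[of X affine] by simp
qed

text \<open>The coefficients \<open>w\<close> are only real. An approximate relation with integer
  coefficients is already exact once its error is small, because all matrices involved have integer
  entries.\<close>

lemma perm_matrix_integer_relation:
  fixes S :: "('n::finite \<Rightarrow> 'n) set" and w :: "('n \<Rightarrow> 'n) \<Rightarrow> real"
  assumes w: "(\<Sum>p\<in>S. w p *\<^sub>R perm_matrix p) = (perm_matrix \<tau> :: real ^ 'n ^ 'n)"
    and "w \<sigma> > 0" "\<sigma> \<in> S"
  obtains q :: int and m :: "('n \<Rightarrow> 'n) \<Rightarrow> int"
  where "q > 0" "m \<sigma> > 0" "\<And>j k. (if j = \<tau> k then q else 0) = entry_sum S m j k"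
proof -
  \<comment> \<open>The bound by \<open>card S\<close> keeps the accumulated error in each entry
    below 1. The bound by \<open>1 / w \<sigma>\<close> keeps the rounded coefficient of \<sigma>
    positive.\<close>
  obtain N where N: "real N > max (real (card S)) (1 / w \<sigma>)"
    using reals_Archimedean2 by blast
  then have N0: "N > 0"
    by (cases N) auto
  obtain q :: int and m :: "('n \<Rightarrow> 'n) \<Rightarrow> int" where q: "q > 0"
    and m: "\<And>p. p \<in> S \<Longrightarrow> \<bar>of_int q * w p - of_int (m p)\<bar> < 1 / real N"
    using Dirichlet_approx_finite[OF _ N0, of S w] by (metis finite_code)
  have "1 / real N < w \<sigma>"
    using N N0 assms(2) by (simp add: field_simps)
  also have "w \<sigma> \<le> of_int q * w \<sigma>"
    using q assms(2) by simp
  finally have "m \<sigma> > 0"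
    using m[OF assms(3)] by linarith
  have "(if j = \<tau> k then q else 0) = entry_sum S m j k" for j k
  proof -
    \<comment> \<open>The error of the approximate relation is an integer of absolute value less than 1.\<close>
    have 1: "(if j = \<tau> k then 1 else 0) = entry_sum S w j k"
      using w sum_scaleR_perm_matrix[of w S j k] by (simp add: perm_matrix_def)
    have "of_int ((if j = \<tau> k then q else 0) - entry_sum S m j k) =
        of_int q * entry_sum S w j k - of_int (entry_sum S m j k)"
      by (simp flip: 1)
    also have "\<dots> = (\<Sum>p\<in>S. if j = p k then of_int q * w p - of_int (m p) else 0)"
      unfolding entry_sum_def of_int_sum sum_distrib_left sum_subtractf[symmetric]
      by (rule sum.cong) auto
    finally have "\<bar>of_int ((if j = \<tau> k then q else 0) - entry_sum S m j k)\<bar> \<le>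
        (\<Sum>p\<in>S. \<bar>if j = p k then of_int q * w p - of_int (m p) else 0\<bar>)"
      by (simp only: sum_abs)
    also have "\<dots> \<le> (\<Sum>p\<in>S. 1 / real N)"
      using m by (intro sum_mono) (auto intro: less_imp_le)
    also have "\<dots> < 1"
      using N N0 by (simp add: field_simps)
    finally show ?thesis
      by linarith
  qed
  with q \<open>m \<sigma> > 0\<close> show thesis
    by (rule that)
qed

text \<open>In terms of the slack \<open>g\<close>, the aim is
  \<open>g \<sigma> \<le> g \<tau>\<close>. A sum of total slack \<open>g \<tau>\<close> is shown to
  have a second expression that contains \<sigma>.\<close>

lemma sum_saturated_facet:
  fixes A :: "('n::finite \<Rightarrow> 'n) set"
  defines "X \<equiv> perm_matrix ` A :: (real ^ 'n ^ 'n) set"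
  assumes sat: "sum_saturated A" and facet: "convex hull X \<inter> {x. a \<bullet> x = b} facet_of convex hull X"
    and le: "\<And>y. y \<in> X \<Longrightarrow> a \<bullet> y \<le> b"
    and \<sigma>: "\<sigma> \<in> A" "a \<bullet> perm_matrix \<sigma> \<noteq> b" and \<tau>: "\<tau> \<in> A" "a \<bullet> perm_matrix \<tau> \<noteq> b"
  shows "a \<bullet> perm_matrix \<tau> \<le> a \<bullet> perm_matrix \<sigma>"
proof -
  let ?P = "perm_matrix :: _ \<Rightarrow> real ^ 'n ^ 'n"
  define g where "g p = b - a \<bullet> ?P p" for p
  have g_nonneg: "g p \<ge> 0" if "p \<in> A" for p
    using le that by (simp add: g_def X_def)
  have g_pos: "g \<sigma> > 0" "g \<tau> > 0"
    using g_nonneg[OF \<sigma>(1)] g_nonneg[OF \<tau>(1)] \<sigma>(2) \<tau>(2) by (auto simp: g_def)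
  define T where "T = {p \<in> A. a \<bullet> ?P p = b}"
  have gT: "g p = 0" if "p \<in> T" for p
    using that by (simp add: g_def T_def)
  have fin: "finite B" for B :: "('n \<Rightarrow> 'n) set"
    by simp
  have \<sigma>T: "\<sigma> \<notin> T" and \<tau>T: "\<tau> \<notin> T" and TA: "T \<subseteq> A"
    using \<sigma> \<tau> by (auto simp: T_def)
  have "X \<subseteq> affine hull (insert (?P \<sigma>) {x \<in> X. a \<bullet> x = b})"
    by (rule facet_of_convex_hull_affine_span[OF _ facet]) (use \<sigma> in \<open>auto simp: X_def\<close>)
  moreover have "insert (?P \<sigma>) {x \<in> X. a \<bullet> x = b} = ?P ` insert \<sigma> T"
    by (auto simp: X_def T_def)
  ultimately have "?P \<tau> \<in> affine hull (?P ` insert \<sigma> T)"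
    using \<tau>(1) by (auto simp: X_def)
  then obtain u where u: "sum u (?P ` insert \<sigma> T) = 1" "(\<Sum>x\<in>?P ` insert \<sigma> T. u x *\<^sub>R x) = ?P \<tau>"
    using affine_hull_finite[of "?P ` insert \<sigma> T"] fin by auto
  define w where "w p = u (?P p)" for p
  have inj: "inj_on ?P (insert \<sigma> T)"
    using inj_perm_matrix inj_on_subset by blast
  have w: "(\<Sum>p\<in>insert \<sigma> T. w p) = 1" "(\<Sum>p\<in>insert \<sigma> T. w p *\<^sub>R ?P p) = ?P \<tau>"
    using u unfolding w_def sum.reindex[OF inj] by (simp_all add: o_def)
  \<comment> \<open>The slack is affine and vanishes on \<open>T\<close>, so only the term of
    \<sigma> survives in the affine combination. Positivity of both slacks then gives the sign of
    \<open>w \<sigma>\<close>.\<close>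
  have "g \<tau> = b * (\<Sum>p\<in>insert \<sigma> T. w p) - a \<bullet> (\<Sum>p\<in>insert \<sigma> T. w p *\<^sub>R ?P p)"
    by (simp only: w g_def mult_1_right)
  also have "\<dots> = (\<Sum>p\<in>insert \<sigma> T. w p * g p)"
    by (simp only: g_def inner_sum_right inner_scaleR_right sum_distrib_left right_diff_distrib
        sum_subtractf mult.commute)
  also have "\<dots> = w \<sigma> * g \<sigma>"
    using \<sigma>T fin by (simp add: gT)
  finally have "w \<sigma> > 0"
    using g_pos by (simp add: zero_less_mult_iff)
  then obtain q :: int and m where q: "q > 0" and m: "m \<sigma> > 0"
    and rel: "\<And>j k. (if j = \<tau> k then q else 0) = entry_sum (insert \<sigma> T) m j k"
    using perm_matrix_integer_relation[OF w(2)] by blast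
  \<comment> \<open>Adding \<open>q * B\<close> copies of every element of \<open>T\<close> to both
    sides of the relation makes all coefficients nonnegative.\<close>
  define B where "B = (\<Sum>p\<in>T. nat \<bar>m p\<bar>)"
  have B: "\<bar>m p\<bar> \<le> q * int B" if "p \<in> T" for p
  proof -
    have "nat \<bar>m p\<bar> \<le> B"
      unfolding B_def using that fin by (intro member_le_sum) auto
    then have "\<bar>m p\<bar> \<le> int B"
      by linarith
    also have "\<dots> \<le> q * int B"
      using q by (simp add: mult_le_cancel_right1)
    finally show ?thesis .
  qed
  \<comment> \<open>\<open>c\<close> encodes \<tau> together with \<open>B\<close> copies of each
    element of \<open>T\<close>; \<open>c'\<close> encodes \<open>q\<close> times the same matrix,
    rewritten by the relation so that \<sigma> occurs.\<close>
  define c where "c p = (if p = \<tau> then 1 else if p \<in> T then B else 0)" for p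
  define c' where "c' p = (if p = \<sigma> then nat (m \<sigma>) else if p \<in> T then nat (m p + q * int B) else 0)"
    for p
  have "nat q * entry_sum A c j k = entry_sum A c' j k" for j k
  proof -
    let ?t = "\<Sum>p\<in>T. if j = p k then int B else 0"
    have "int (entry_sum A c j k) = (\<Sum>p\<in>insert \<tau> T. if j = p k then int (c p) else 0)"
      unfolding of_nat_entry_sum unfolding entry_sum_def
      by (rule sum.mono_neutral_right) (use TA \<tau> fin in \<open>auto simp: c_def\<close>)
    also have "\<dots> = (if j = \<tau> k then 1 else 0) + (\<Sum>p\<in>T. if j = p k then int (c p) else 0)"
      using \<tau>T fin by (simp add: c_def)
    also have "(\<Sum>p\<in>T. if j = p k then int (c p) else 0) = ?t"
      using \<tau>T by (intro sum.cong) (auto simp: c_def)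
    finally have c: "int (entry_sum A c j k) = (if j = \<tau> k then 1 else 0) + ?t" .
    have "int (entry_sum A c' j k) = (\<Sum>p\<in>insert \<sigma> T. if j = p k then int (c' p) else 0)"
      unfolding of_nat_entry_sum unfolding entry_sum_def
      by (rule sum.mono_neutral_right) (use TA \<sigma> fin in \<open>auto simp: c'_def\<close>)
    also have "\<dots> = (if j = \<sigma> k then m \<sigma> else 0) + (\<Sum>p\<in>T. if j = p k then int (c' p) else 0)"
      using \<sigma>T fin m by (simp add: c'_def)
    also have "(\<Sum>p\<in>T. if j = p k then int (c' p) else 0) =
        (\<Sum>p\<in>T. (if j = p k then m p else 0) + q * (if j = p k then int B else 0))"
    proof (intro sum.cong refl)
      fix p
      assume p: "p \<in> T"
      then have "p \<noteq> \<sigma>" "m p + q * int B \<ge> 0"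
        using \<sigma>T B[OF p] by auto
      with p show "(if j = p k then int (c' p) else 0) =
          (if j = p k then m p else 0) + q * (if j = p k then int B else 0)"
        by (simp add: c'_def)
    qed
    also have "\<dots> = (\<Sum>p\<in>T. if j = p k then m p else 0) + q * ?t"
      by (simp only: sum.distrib sum_distrib_left)
    finally have "int (entry_sum A c' j k) = entry_sum (insert \<sigma> T) m j k + q * ?t"
      using \<sigma>T fin by (simp add: entry_sum_def)
    also have "\<dots> = q * int (entry_sum A c j k)"
      by (simp add: c distrib_left flip: rel)
    also have "\<dots> = int (nat q * entry_sum A c j k)"
      using q by simp
    finally show ?thesis
      by linarith
  qed
  moreover have "c' \<sigma> > 0"
    using m by (simp add: c'_def)
  ultimately obtain d where d: "d \<sigma> > 0" "entry_sum A d = entry_sum A c"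
    using sat \<sigma>(1) unfolding sum_saturated_def by blast
  \<comment> \<open>The total slack depends only on the number of summands and on the summed matrix,
    and \<open>c\<close> and \<open>d\<close> agree in both.\<close>
  have slack: "(\<Sum>p\<in>A. real (e p) * g p) =
      b * real (\<Sum>p\<in>A. e p) - a \<bullet> (\<Sum>p\<in>A. real (e p) *\<^sub>R ?P p)" for e :: "_ \<Rightarrow> nat"
    by (simp add: g_def inner_sum_right sum_distrib_left right_diff_distrib sum_subtractf mult.commute)
  \<comment> \<open>Any column counts the summands; \<open>undefined\<close> picks one.\<close>
  have "(\<Sum>p\<in>A. d p) = (\<Sum>p\<in>A. c p)"
    by (simp only: sum_entry_sum[of A _ undefined, symmetric] d(2))
  moreover have "(\<Sum>p\<in>A. real (d p) *\<^sub>R ?P p) = (\<Sum>p\<in>A. real (c p) *\<^sub>R ?P p)"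
    unfolding vec_eq_iff sum_scaleR_perm_matrix using d(2) by (simp flip: of_nat_entry_sum)
  ultimately have eq: "(\<Sum>p\<in>A. real (d p) * g p) = (\<Sum>p\<in>A. real (c p) * g p)"
    by (simp only: slack)
  \<comment> \<open>On the side of \<open>d\<close> all terms are nonnegative and \<sigma>
    contributes; on the side of \<open>c\<close> only \<tau>, with multiplicity 1, has nonzero
    slack.\<close>
  have "g \<sigma> \<le> real (d \<sigma>) * g \<sigma>"
    using d(1) g_pos by simp
  also have "\<dots> \<le> (\<Sum>p\<in>A. real (d p) * g p)"
    using \<sigma>(1) g_nonneg fin by (intro member_le_sum) auto
  also have "\<dots> = (\<Sum>p\<in>{\<tau>}. real (c p) * g p)"
    unfolding eq by (rule sum.mono_neutral_right) (use \<tau> gT fin in \<open>auto simp: c_def\<close>)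
  finally show ?thesis
    by (simp add: c_def g_def)
qed

text \<open>Comparing two elements off a facet in both directions leaves a single value there, as
  the facet criterion requires.\<close>

theorem sum_saturated_imp_theta_exact:
  fixes A :: "('n::finite \<Rightarrow> 'n) set"
  assumes "sum_saturated A"
  shows "theta_exact A"
  unfolding theta_exact_def
proof (rule convex_hull_eq_theta_body)
  let ?X = "perm_matrix ` A :: (real ^ 'n ^ 'n) set"
  show "finite ?X"
    by simp
  fix a :: "real ^ 'n ^ 'n" and b
  assume facet: "convex hull ?X \<inter> {x. a \<bullet> x = b} facet_of convex hull ?X"
    and le: "\<And>y. y \<in> ?X \<Longrightarrow> a \<bullet> y \<le> b"
  show "\<exists>s. \<forall>y\<in>?X. a \<bullet> y = b \<or> a \<bullet> y = s"
  proof (cases "\<exists>\<sigma>\<in>A. a \<bullet> perm_matrix \<sigma> \<noteq> b")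
    case True
    then obtain \<sigma> where \<sigma>: "\<sigma> \<in> A" "a \<bullet> perm_matrix \<sigma> \<noteq> b"
      by blast
    have "a \<bullet> perm_matrix \<tau> = a \<bullet> perm_matrix \<sigma>" if "\<tau> \<in> A" "a \<bullet> perm_matrix \<tau> \<noteq> b" for \<tau>
      using sum_saturated_facet[OF assms facet le \<sigma> that]
        sum_saturated_facet[OF assms facet le that \<sigma>] by simp
    then show ?thesis
      by blast
  qed blast
qed

section \<open>Permutation summable groups are saturated\<close>

lemma exists_list_count:
  assumes "finite A"
  shows "\<exists>ps. set ps \<subseteq> A \<and> (\<forall>p\<in>A. count_list ps p = c p)"
  using assms
proof (induction A rule: finite_induct)
  case (insert x F)
  then obtain ps where ps: "set ps \<subseteq> F" "\<forall>p\<in>F. count_list ps p = c p"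
    by blast
  have count: "count_list (replicate n x) p = (if p = x then n else 0)" for n p
    by (induction n) auto
  have "count_list ps x = 0"
    using ps(1) insert.hyps by (auto simp: count_list_0_iff)
  moreover have "set (replicate (c x) x @ ps) \<subseteq> insert x F"
    using ps(1) by auto
  ultimately show ?case
    using ps(2) by (intro exI[of _ "replicate (c x) x @ ps"]) (auto simp: count)
qed simp

text \<open>Links the lists of \<open>permutation_summable\<close> to the multiplicities of
  \<open>sum_saturated\<close>.\<close>

lemma sum_list_perm_matrix:
  fixes ps :: "('n::finite \<Rightarrow> 'n) list"
  assumes "set ps \<subseteq> A"
  shows "(\<Sum>p\<leftarrow>ps. perm_matrix p :: int ^ 'n ^ 'n) $ j $ k = int (entry_sum A (count_list ps) j k)"
  using assms
proof (induction ps)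
  case Nil
  show ?case
    by (simp add: entry_sum_def cong: if_cong)
next
  case (Cons x ps)
  have "entry_sum A (count_list (x # ps)) j k =
      (\<Sum>p\<in>A. (if p = x then if j = x k then 1 else 0 else 0) + (if j = p k then count_list ps p else 0))"
    unfolding entry_sum_def by (intro sum.cong) auto
  also have "\<dots> = (if j = x k then 1 else 0) + entry_sum A (count_list ps) j k"
    using Cons.prems unfolding entry_sum_def sum.distrib by (subst sum.delta) auto
  finally have *: "entry_sum A (count_list (x # ps)) j k = \<dots>" .
  show ?case
    unfolding * using Cons by (simp add: perm_matrix_def)
qed

text \<open>Over \<open>UNIV\<close> the restrictions built into \<open>BijGroup\<close> are
  vacuous, which leaves ordinary composition and inversion.\<close>

lemma subgroup_BijGroup_UNIV:
  assumes "subgroup A (BijGroup UNIV)"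
  shows "\<sigma> \<in> A \<Longrightarrow> bij \<sigma>"
    and "\<sigma> \<in> A \<Longrightarrow> \<tau> \<in> A \<Longrightarrow> \<sigma> \<circ> \<tau> \<in> A"
    and "\<sigma> \<in> A \<Longrightarrow> inv_into UNIV \<sigma> \<in> A"
proof -
  have sub: "A \<subseteq> Bij UNIV"
    using subgroup.subset[OF assms] by (simp add: BijGroup_def)
  then show "\<sigma> \<in> A \<Longrightarrow> bij \<sigma>"
    by (auto simp: Bij_def)
  show "\<sigma> \<circ> \<tau> \<in> A" if "\<sigma> \<in> A" "\<tau> \<in> A"
    using subgroup.m_closed[OF assms that] that sub
    by (auto simp: BijGroup_def compose_def o_def restrict_def subset_iff)
  show "inv_into UNIV \<sigma> \<in> A" if "\<sigma> \<in> A"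
    using subgroup.m_inv_closed[OF assms that] that sub
    by (auto simp: inv_BijGroup restrict_def)
qed

text \<open>Composing with \<sigma> on the left moves row \<open>j\<close> to row
  \<open>\<sigma> j\<close>.\<close>

lemma sum_list_map_perm_matrix_comp:
  fixes ps :: "('n::finite \<Rightarrow> 'n) list"
  assumes "bij \<sigma>"
  shows "(\<Sum>p\<leftarrow>map ((\<circ>) \<sigma>) ps. perm_matrix p :: int ^ 'n ^ 'n) $ \<sigma> j $ k =
    (\<Sum>p\<leftarrow>ps. perm_matrix p) $ j $ k"
  using assms by (induction ps) (auto simp: perm_matrix_def bij_is_inj inj_eq)

text \<open>Summability removes only the identity. Translating the sum by the inverse of \<sigma>
  turns \<sigma> into the identity, and translating back restores the original sum with \<sigma>
  split off.\<close>

theorem permutation_summable_imp_sum_saturated: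
  fixes A :: "('n::finite \<Rightarrow> 'n) set"
  assumes A: "subgroup A (BijGroup UNIV)" and "permutation_summable A"
  shows "sum_saturated A"
  unfolding sum_saturated_def
proof (intro ballI allI impI)
  fix \<sigma> and c c' :: "_ \<Rightarrow> nat" and N
  assume \<sigma>: "\<sigma> \<in> A" "c' \<sigma> > 0" and eq: "\<forall>j k. N * entry_sum A c j k = entry_sum A c' j k"
  let ?M = "\<lambda>ps. (\<Sum>p\<leftarrow>ps. perm_matrix p) :: int ^ 'n ^ 'n"
  let ?i = "inv_into UNIV \<sigma>"
  have bij: "bij \<sigma>" "bij ?i"
    using subgroup_BijGroup_UNIV(1)[OF A] \<sigma>(1) bij_imp_bij_inv by auto
  then have \<sigma>i: "\<sigma> (?i j) = j" "?i (\<sigma> j) = j" for j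
    by (simp_all add: bij_is_surj surj_f_inv_f bij_is_inj)
  obtain ps where ps: "set ps \<subseteq> A" "\<forall>p\<in>A. count_list ps p = c p"
    using exists_list_count[of A c] by auto
  have M_ps: "?M ps $ j $ k = int (entry_sum A c j k)" for j k
    unfolding sum_list_perm_matrix[OF ps(1)] entry_sum_def using ps(2)
    by (intro arg_cong[of _ _ int] sum.cong) auto
  \<comment> \<open>A zero entry would stay zero after multiplication by \<open>N\<close>, but the
    multiple has positive entries wherever the matrix of \<sigma> has a 1.\<close>
  have pos: "?M ps $ \<sigma> k $ k \<ge> 1" for k
  proof -
    have "c' \<sigma> \<le> entry_sum A c' (\<sigma> k) k"
      unfolding entry_sum_def using \<sigma>(1) member_le_sum[of \<sigma> A "\<lambda>p. if \<sigma> k = p k then c' p else 0"]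
      by simp
    then have "entry_sum A c (\<sigma> k) k \<noteq> 0"
      using \<sigma>(2) eq[rule_format, of "\<sigma> k" k] by (cases "entry_sum A c (\<sigma> k) k = 0") auto
    then show ?thesis
      by (simp add: M_ps)
  qed
  let ?ps = "map ((\<circ>) ?i) ps"
  have M_ips: "?M ?ps $ j $ k = ?M ps $ \<sigma> j $ k" for j k
    using sum_list_map_perm_matrix_comp[OF bij(2), of ps "\<sigma> j" k] by (simp add: \<sigma>i)
  have "set ?ps \<subseteq> A"
    using ps(1) subgroup_BijGroup_UNIV(2,3)[OF A] \<sigma>(1) by auto
  moreover have "(?M ?ps - mat 1) $ j $ k \<ge> 0" for j k
  proof (cases "j = k")
    case True
    then show ?thesis
      using pos[of k] by (simp only: vector_minus_component M_ips) (simp add: mat_def)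
  next
    case False
    then show ?thesis
      by (simp only: vector_minus_component M_ips) (simp add: mat_def M_ps)
  qed
  ultimately obtain qs where qs: "set qs \<subseteq> A" "?M ?ps - mat 1 = ?M qs"
    using assms(2) unfolding permutation_summable_def by blast
  let ?qs = "\<sigma> # map ((\<circ>) \<sigma>) qs"
  have "set ?qs \<subseteq> A"
    using qs(1) subgroup_BijGroup_UNIV(2)[OF A] \<sigma>(1) by auto
  have "?M ?qs $ j $ k = ?M ps $ j $ k" for j k
  proof -
    have "?M qs $ ?i j $ k = ?M ps $ j $ k - (mat 1 :: int ^ 'n ^ 'n) $ ?i j $ k"
      using M_ips[of "?i j" k] unfolding qs(2)[symmetric] vector_minus_component by (simp only: \<sigma>i)
    moreover have "?M (map ((\<circ>) \<sigma>) qs) $ j $ k = ?M qs $ ?i j $ k"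
      using sum_list_map_perm_matrix_comp[OF bij(1), of qs "?i j" k] by (simp only: \<sigma>i)
    moreover have "(mat 1 :: int ^ 'n ^ 'n) $ ?i j $ k = perm_matrix \<sigma> $ j $ k"
      using \<sigma>i by (auto simp: mat_def perm_matrix_def)
    ultimately show ?thesis
      by (simp only: list.map sum_list.Cons vector_add_component)
  qed
  then have "entry_sum A (count_list ?qs) j k = entry_sum A c j k" for j k
    unfolding sum_list_perm_matrix[OF \<open>set ?qs \<subseteq> A\<close>] M_ps by (simp only: of_nat_eq_iff)
  then have "entry_sum A (count_list ?qs) = entry_sum A c"
    by blast
  moreover have "count_list ?qs \<sigma> > 0"
    by simp
  ultimately show "\<exists>d. d \<sigma> > 0 \<and> entry_sum A d = entry_sum A c"
    by blast
qed

section \<open>Graded reverse lexicographic orders and monomial ideals\<close>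

lemma linear_order_onD:
  assumes "linear_order_on V r"
  shows "Field r = V" "(u, v) \<in> r \<Longrightarrow> (v, w) \<in> r \<Longrightarrow> (u, w) \<in> r"
    "(u, v) \<in> r \<Longrightarrow> (v, u) \<in> r \<Longrightarrow> u = v"
    "u \<in> V \<Longrightarrow> v \<in> V \<Longrightarrow> (u, v) \<in> r \<or> (v, u) \<in> r"
proof -
  have r: "r \<subseteq> V \<times> V" "refl_on V r" "trans r" "antisym r" "total_on V r"
    using assms by (simp_all add: order_on_defs)
  show "Field r = V"
    using r(1,2) by (auto simp: Field_def refl_on_def)
  show "(u, v) \<in> r \<Longrightarrow> (v, w) \<in> r \<Longrightarrow> (u, w) \<in> r"
    using r(3) by (rule transD)
  show "(u, v) \<in> r \<Longrightarrow> (v, u) \<in> r \<Longrightarrow> u = v"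
    using r(4) by (rule antisymD)
  show "u \<in> V \<Longrightarrow> v \<in> V \<Longrightarrow> (u, v) \<in> r \<or> (v, u) \<in> r"
    using r(2,5) by (cases "u = v") (auto simp: refl_on_def total_on_def)
qed

text \<open>Any linear order of the other elements works, with \<open>x\<close> placed below them; a
  well-order supplies one.\<close>

lemma linear_order_on_least_element:
  assumes "x \<in> A"
  obtains r where "linear_order_on A r" "\<And>u. (u, x) \<in> r \<Longrightarrow> u = x"
proof -
  obtain r0 where "well_order_on (A - {x}) r0"
    using well_order_on by blast
  then have r0: "linear_order_on (A - {x}) r0"
    by (simp add: well_order_on_def)
  define r where "r = {x} \<times> A \<union> r0"
  note r0' = linear_order_onD[OF r0]
  have f: "u \<in> A - {x}" "v \<in> A - {x}" if "(u, v) \<in> r0" for u v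
    using that r0'(1) by (auto simp: Field_def)
  have "linear_order_on A r"
    unfolding order_on_defs
  proof (intro conjI)
    show "r \<subseteq> A \<times> A"
      using assms f by (auto simp: r_def)
    show "refl_on A r"
      using r0'(4) by (auto simp: refl_on_def r_def)
    show "trans r"
      unfolding r_def using f r0'(2) by (intro transI) blast
    show "antisym r"
      unfolding r_def using f r0'(3) by (intro antisymI) blast
    show "total_on A r"
      unfolding r_def total_on_def using r0'(4) by blast
  qed
  moreover have "u = x" if "(u, x) \<in> r" for u
    using that f by (auto simp: r_def)
  ultimately show thesis
    by (rule that)
qed

lemma grevlex_less_irrefl: "\<not> grevlex_less r a a"
  by (auto simp: grevlex_less_def)

lemma grevlex_less_trans:
  assumes r: "linear_order_on V r" and "grevlex_less r a b" "grevlex_less r b c"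
  shows "grevlex_less r a c"
proof -
  let ?l = "Poly_Mapping.lookup"
  show ?thesis
  proof (cases "monom_degree a < monom_degree c")
    case False
    then have deg: "monom_degree a = monom_degree b" "monom_degree b = monom_degree c"
      using assms(2,3) by (auto simp: grevlex_less_def)
    obtain v where v: "v \<in> V" "?l a v > ?l b v" "\<And>u. (u, v) \<in> r \<Longrightarrow> u \<noteq> v \<Longrightarrow> ?l a u = ?l b u"
      using assms(2) deg linear_order_onD(1)[OF r] by (auto simp: grevlex_less_def)
    obtain w where w: "w \<in> V" "?l b w > ?l c w" "\<And>u. (u, w) \<in> r \<Longrightarrow> u \<noteq> w \<Longrightarrow> ?l b u = ?l c u"
      using assms(3) deg linear_order_onD(1)[OF r] by (auto simp: grevlex_less_def)
    \<comment> \<open>The smaller of the two deciding variables decides the comparison of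
      \<open>a\<close> with \<open>c\<close>.\<close>
    define x where "x = (if (v, w) \<in> r then v else w)"
    have x: "(x, v) \<in> r" "(x, w) \<in> r" "x \<in> V" "x = v \<or> x = w"
      using linear_order_onD(4)[OF r] v(1) w(1) by (auto simp: x_def)
    have "?l a x > ?l c x"
    proof (cases "x = v")
      case True
      then show ?thesis
        using v(2) w(2) w(3)[of v] x by (cases "v = w") auto
    next
      case False
      then show ?thesis
        using v(3)[of w] w(2) x by auto
    qed
    moreover have "?l a u = ?l c u" if "(u, x) \<in> r" "u \<noteq> x" for u
    proof -
      have "(u, v) \<in> r" "(u, w) \<in> r"
        using linear_order_onD(2)[OF r] that(1) x(1,2) by blast+
      moreover have "u \<noteq> v" "u \<noteq> w"
        using linear_order_onD(3)[OF r] that x(1,2) by blast+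
      ultimately show ?thesis
        using v(3) w(3) by simp
    qed
    ultimately show ?thesis
      using deg x(3) linear_order_onD(1)[OF r] by (auto simp: grevlex_less_def)
  qed (simp add: grevlex_less_def)
qed

text \<open>For equal degrees, the least variable at which the exponents differ decides; the bounds
  on the keys place it in \<open>V\<close>.\<close>

lemma grevlex_less_total:
  assumes "finite V" and r: "linear_order_on V r"
    and keys: "Poly_Mapping.keys a \<subseteq> V" "Poly_Mapping.keys b \<subseteq> V" and "a \<noteq> b"
  shows "grevlex_less r a b \<or> grevlex_less r b a"
proof -
  let ?l = "Poly_Mapping.lookup"
  let ?D = "{v \<in> V. ?l a v \<noteq> ?l b v}"
  have "?D \<noteq> {}"
  proof
    assume D: "?D = {}"
    have "?l a v = ?l b v" for v
    proof (cases "v \<in> V")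
      case False
      then show ?thesis
        using keys by (metis in_keys_iff subsetD)
    qed (use D in blast)
    with \<open>a \<noteq> b\<close> show False
      using poly_mapping_eqI by blast
  qed
  moreover have "transp_on ?D (\<lambda>u v. (u, v) \<in> r)" "totalp_on ?D (\<lambda>u v. (u, v) \<in> r)"
    using linear_order_onD(2,4)[OF r] by (auto simp: transp_on_def totalp_on_def)
  ultimately obtain v where v: "v \<in> ?D" "\<forall>u\<in>?D. u \<noteq> v \<longrightarrow> (v, u) \<in> r"
    using Finite_Set.bex_least_element[of ?D "\<lambda>u v. (u, v) \<in> r"] assms(1) by auto
  have "?l a u = ?l b u" if "(u, v) \<in> r" "u \<noteq> v" for u
  proof -
    have "u \<in> V"
      using that(1) linear_order_onD(1)[OF r] by (auto simp: Field_def)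
    then show ?thesis
      using v(2) that linear_order_onD(3)[OF r] by blast
  qed
  with v(1) show ?thesis
    unfolding grevlex_less_def linear_order_onD(1)[OF r]
    by (metis (mono_tags, lifting) linorder_neqE_nat mem_Collect_eq)
qed

lemma grevlex_less_add_cancel: "grevlex_less r (a + n) (b + n) \<longleftrightarrow> grevlex_less r a b"
  by (simp add: grevlex_less_def monom_degree_add lookup_add)

text \<open>\<open>lead_monom\<close> is a definite description. A greatest element of the finite
  support exists by totality and is unique by transitivity and irreflexivity.\<close>

lemma lead_monom_grevlex:
  assumes "finite V" and r: "linear_order_on V r" and "p \<noteq> 0"
    and keys: "\<forall>m\<in>Poly_Mapping.keys p. Poly_Mapping.keys m \<subseteq> V"
  shows "lead_monom (grevlex_less r) p \<in> Poly_Mapping.keys p"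
    and "m \<in> Poly_Mapping.keys p \<Longrightarrow> m \<noteq> lead_monom (grevlex_less r) p \<Longrightarrow>
      grevlex_less r m (lead_monom (grevlex_less r) p)"
proof -
  let ?K = "Poly_Mapping.keys p"
  let ?Q = "\<lambda>m. m \<in> ?K \<and> (\<forall>m'\<in>?K. m' \<noteq> m \<longrightarrow> grevlex_less r m' m)"
  have "?K \<noteq> {}"
    using \<open>p \<noteq> 0\<close> by simp
  moreover have "transp_on ?K (grevlex_less r)"
    using grevlex_less_trans[OF r] by (intro transp_onI)
  moreover have "totalp_on ?K (grevlex_less r)"
    using grevlex_less_total[OF assms(1) r] keys by (intro totalp_onI) blast
  ultimately obtain m0 where m0: "?Q m0"
    using Finite_Set.bex_greatest_element[of ?K "grevlex_less r"] by auto
  have "m1 = m0" if "?Q m1" for m1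
    using that m0 grevlex_less_trans[OF r] grevlex_less_irrefl by metis
  with m0 have "?Q (lead_monom (grevlex_less r) p)"
    unfolding lead_monom_def by (rule theI)
  then show "lead_monom (grevlex_less r) p \<in> ?K"
    and "m \<in> ?K \<Longrightarrow> m \<noteq> lead_monom (grevlex_less r) p \<Longrightarrow>
      grevlex_less r m (lead_monom (grevlex_less r) p)"
    by auto
qed

section \<open>Monomial ideals in the polynomial ring\<close>

lemma ring_mpoly_ring: "ring (mpoly_ring V :: ('a, 'b::comm_ring_1) mpoly ring)"
  (is "ring ?R")
proof (rule ringI)
  show "abelian_group ?R"
  proof (rule abelian_groupI)
    fix p :: "('a, 'b) mpoly"
    assume "p \<in> carrier ?R"
    then show "\<exists>q\<in>carrier ?R. q \<oplus>\<^bsub>?R\<^esub> p = \<zero>\<^bsub>?R\<^esub>"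
      by (intro bexI[of _ "- p"]) (auto simp: mpoly_ring_def in_keys_iff)
  next
    fix p q :: "('a, 'b) mpoly"
    assume "p \<in> carrier ?R" "q \<in> carrier ?R"
    then show "p \<oplus>\<^bsub>?R\<^esub> q \<in> carrier ?R"
      using keys_add[of p q] by (auto simp: mpoly_ring_def)
  qed (auto simp: mpoly_ring_def add_ac)
  show "monoid ?R"
  proof (rule monoidI)
    fix p q :: "('a, 'b) mpoly"
    assume pq: "p \<in> carrier ?R" "q \<in> carrier ?R"
    have "Poly_Mapping.keys m \<subseteq> V" if m: "m \<in> Poly_Mapping.keys (p * q)" for m
    proof -
      obtain a b where "m = a + b" "a \<in> Poly_Mapping.keys p" "b \<in> Poly_Mapping.keys q"
        using m keys_mult[of p q] by blast
      then show ?thesis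
        using pq keys_add[of a b] by (simp add: mpoly_ring_def) blast
    qed
    then show "p \<otimes>\<^bsub>?R\<^esub> q \<in> carrier ?R"
      by (simp add: mpoly_ring_def)
  qed (auto simp: mpoly_ring_def mult_ac)
qed (auto simp: mpoly_ring_def algebra_simps)

text \<open>With additive exponents, \<open>m = s + n\<close> says that \<open>s\<close> divides
  \<open>m\<close>. Each monomial of a product is a multiple of a monomial of either factor, which
  gives absorption; negation is multiplication by minus one.\<close>

lemma ideal_keys_divisible:
  "ideal {p \<in> carrier (mpoly_ring V). \<forall>m\<in>Poly_Mapping.keys p. \<exists>s\<in>S. \<exists>n. m = s + n} (mpoly_ring V)"
    (is "ideal ?J ?R")
proof (rule idealI[OF ring_mpoly_ring])
  interpret ring ?R
    by (rule ring_mpoly_ring)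
  have J_mult: "p \<otimes>\<^bsub>?R\<^esub> q \<in> ?J" "q \<otimes>\<^bsub>?R\<^esub> p \<in> ?J" if "p \<in> ?J" "q \<in> carrier ?R" for p q
  proof -
    have "\<exists>s\<in>S. \<exists>n. m = s + n" if m: "m \<in> Poly_Mapping.keys (p * q)" for m
    proof -
      obtain a b where ab: "m = a + b" "a \<in> Poly_Mapping.keys p"
        using m keys_mult[of p q] by blast
      then obtain s n where "s \<in> S" "a = s + n"
        using \<open>p \<in> ?J\<close> by blast
      then show ?thesis
        using ab(1) by (auto simp: add.assoc)
    qed
    moreover have "p \<otimes>\<^bsub>?R\<^esub> q = p * q" "q \<otimes>\<^bsub>?R\<^esub> p = p * q"
      by (simp_all add: mpoly_ring_def mult.commute)
    moreover have "p \<otimes>\<^bsub>?R\<^esub> q \<in> carrier ?R"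
      using that by auto
    ultimately show "p \<otimes>\<^bsub>?R\<^esub> q \<in> ?J" "q \<otimes>\<^bsub>?R\<^esub> p \<in> ?J"
      by auto
  qed
  then show "\<And>p q. p \<in> ?J \<Longrightarrow> q \<in> carrier ?R \<Longrightarrow> q \<otimes>\<^bsub>?R\<^esub> p \<in> ?J"
    and "\<And>p q. p \<in> ?J \<Longrightarrow> q \<in> carrier ?R \<Longrightarrow> p \<otimes>\<^bsub>?R\<^esub> q \<in> ?J"
    by blast+
  show "subgroup ?J (add_monoid ?R)"
  proof (rule group.subgroupI)
    show "group (add_monoid ?R)"
      by (rule a_group)
    show "?J \<subseteq> carrier (add_monoid ?R)"
      by auto
    have "0 \<in> ?J"
      by (simp add: mpoly_ring_def)
    then show "?J \<noteq> {}"
      by blast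
    fix p
    assume p: "p \<in> ?J"
    have "\<ominus>\<^bsub>?R\<^esub> p = \<ominus>\<^bsub>?R\<^esub> \<one>\<^bsub>?R\<^esub> \<otimes>\<^bsub>?R\<^esub> p"
      using p by (simp add: l_minus)
    also have "\<dots> \<in> ?J"
      using p by (intro J_mult) auto
    finally show "inv\<^bsub>add_monoid ?R\<^esub> p \<in> ?J"
      by (simp only: a_inv_def)
    fix q
    assume q: "q \<in> ?J"
    have "p \<oplus>\<^bsub>?R\<^esub> q \<in> carrier ?R"
      using p q by auto
    moreover have "p \<oplus>\<^bsub>?R\<^esub> q = p + q"
      by (simp add: mpoly_ring_def)
    moreover have "\<exists>s\<in>S. \<exists>n. m = s + n" if "m \<in> Poly_Mapping.keys (p + q)" for m
      using that keys_add[of p q] p q by blast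
    ultimately show "p \<otimes>\<^bsub>add_monoid ?R\<^esub> q \<in> ?J"
      by simp
  qed
qed

text \<open>The generated ideal is the least one containing the leading monomials, hence lies inside
  the ideal of the previous lemma.\<close>

lemma initial_ideal_keys_divisible:
  assumes lead: "\<forall>p\<in>S - {0}. Poly_Mapping.keys (lead_monom lt p) \<subseteq> V"
    and "f \<in> initial_ideal V lt S" "m \<in> Poly_Mapping.keys f"
  obtains p n where "p \<in> S" "p \<noteq> 0" "m = lead_monom lt p + n"
proof -
  let ?J = "{f \<in> carrier (mpoly_ring V). \<forall>m\<in>Poly_Mapping.keys f.
    \<exists>s\<in>lead_monom lt ` (S - {0}). \<exists>n. m = s + n}"
  have "Poly_Mapping.single (lead_monom lt p) 1 \<in> ?J" if "p \<in> S - {0}" for p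
  proof -
    have "\<exists>s\<in>lead_monom lt ` (S - {0}). \<exists>n. lead_monom lt p = s + n"
      using that by (metis add_0_right image_eqI)
    then show ?thesis
      using that lead by (simp add: mpoly_ring_def)
  qed
  then have "initial_ideal V lt S \<subseteq> ?J"
    unfolding initial_ideal_def using ideal_keys_divisible
    by (intro ring.genideal_minimal[OF ring_mpoly_ring]) blast+
  then show thesis
    using assms(2,3) that by blast
qed

section \<open>The toric ideal\<close>

text \<open>The exponent vector of the image of the monomial \<open>m\<close> under the toric map;
  monomials of equal weight form a fibre. The index type is finite, so every function is a
  legitimate exponent vector.\<close>

definition toric_weight :: "('n::finite \<Rightarrow> 'n) monom \<Rightarrow> ('n \<times> 'n) monom" where
  "toric_weight m = Abs_poly_mapping (\<lambda>(j, k). entry_sum UNIV (Poly_Mapping.lookup m) j k)"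

lemma lookup_toric_weight:
  "Poly_Mapping.lookup (toric_weight m) (j, k) = entry_sum UNIV (Poly_Mapping.lookup m) j k"
  by (simp add: toric_weight_def)

lemma entry_sum_lookup:
  fixes A :: "('n::finite \<Rightarrow> 'n) set"
  assumes "Poly_Mapping.keys m \<subseteq> A"
  shows "entry_sum UNIV (Poly_Mapping.lookup m) = entry_sum A (Poly_Mapping.lookup m)"
  unfolding entry_sum_def fun_eq_iff
  by (intro allI sum.mono_neutral_right) (use assms in \<open>auto simp: in_keys_iff subset_iff\<close>)

lemma toric_weight_eq_iff:
  fixes A :: "('n::finite \<Rightarrow> 'n) set"
  assumes "Poly_Mapping.keys m \<subseteq> A" "Poly_Mapping.keys m' \<subseteq> A"
  shows "toric_weight m = toric_weight m' \<longleftrightarrow>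
    entry_sum A (Poly_Mapping.lookup m) = entry_sum A (Poly_Mapping.lookup m')"
proof -
  have "toric_weight m = toric_weight m' \<longleftrightarrow>
      (\<forall>x. Poly_Mapping.lookup (toric_weight m) x = Poly_Mapping.lookup (toric_weight m') x)"
    by (auto intro: poly_mapping_eqI)
  also have "\<dots> \<longleftrightarrow> entry_sum UNIV (Poly_Mapping.lookup m) = entry_sum UNIV (Poly_Mapping.lookup m')"
    by (simp add: split_paired_all lookup_toric_weight fun_eq_iff)
  finally show ?thesis
    by (simp only: entry_sum_lookup[OF assms(1)] entry_sum_lookup[OF assms(2)])
qed

lemma toric_weight_add: "toric_weight (m + n) = toric_weight m + toric_weight n"
proof (rule poly_mapping_eqI)
  fix x :: "'a \<times> 'a"
  show "Poly_Mapping.lookup (toric_weight (m + n)) x =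
      Poly_Mapping.lookup (toric_weight m + toric_weight n) x"
    by (cases x) (auto simp: lookup_add lookup_toric_weight entry_sum_def simp flip: sum.distrib
        intro!: sum.cong)
qed

text \<open>A column sum of the weight is the degree. Inside a fibre the order is therefore decided
  by exponents alone.\<close>

lemma monom_degree_eq_if_toric_weight_eq:
  assumes "toric_weight m = toric_weight m'"
  shows "monom_degree m = monom_degree m'"
proof -
  have "monom_degree m = (\<Sum>j\<in>UNIV. Poly_Mapping.lookup (toric_weight m) (j, k))" for m and k :: 'a
    by (simp add: lookup_toric_weight sum_entry_sum monom_degree_superset[of UNIV])
  then show ?thesis
    using assms by metis
qed

lemma prod_single_1:
  "(\<Prod>i\<in>I. Poly_Mapping.single (f i) (1::'b::comm_semiring_1)) =
    Poly_Mapping.single (\<Sum>i\<in>I. f i :: 'v monom) 1"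
  by (induction I rule: infinite_finite_induct) (simp_all add: mult_single)

lemma single_1_power:
  "Poly_Mapping.single m (1::'b::comm_semiring_1) ^ n = Poly_Mapping.single (\<Sum>i<n. m :: 'v monom) 1"
  by (induction n) (simp_all add: mult_single add.commute)

text \<open>Every variable goes to a monomial, so each monomial goes to a single monomial; the
  nested sum in \<open>weight\<close> collects the exponents of the iterated product.\<close>

lemma toric_map_eq:
  "toric_map p = (\<Sum>m\<in>Poly_Mapping.keys p.
     Poly_Mapping.single (toric_weight m) (Poly_Mapping.lookup p m))"
proof -
  let ?a = "\<lambda>\<sigma>. \<Prod>j\<in>UNIV. \<Prod>k\<in>UNIV.
    mvar (j, k) ^ ((perm_matrix \<sigma> :: nat ^ 'a ^ 'a) $ j $ k) :: ('a \<times> 'a, complex) mpoly"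
  have weight: "(\<Sum>\<sigma>\<in>Poly_Mapping.keys m. \<Sum>i<Poly_Mapping.lookup m \<sigma>. \<Sum>j\<in>UNIV. \<Sum>k\<in>UNIV.
      \<Sum>i<(perm_matrix \<sigma> :: nat ^ 'a ^ 'a) $ j $ k. Poly_Mapping.single (j, k) (1::nat)) = toric_weight m"
    for m
  proof (rule poly_mapping_eqI)
    fix x :: "'a \<times> 'a"
    obtain j k where x: "x = (j, k)"
      by (cases x)
    have "(\<Sum>j'\<in>UNIV. \<Sum>k'\<in>UNIV. perm_matrix \<sigma> $ j' $ k' *
        Poly_Mapping.lookup (Poly_Mapping.single (j', k') (1::nat)) (j, k)) =
        (if j = \<sigma> k then 1 else 0)" for \<sigma> :: "'a \<Rightarrow> 'a"
    proof -
      have "(\<Sum>j'\<in>UNIV. \<Sum>k'\<in>UNIV. perm_matrix \<sigma> $ j' $ k' *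
          Poly_Mapping.lookup (Poly_Mapping.single (j', k') (1::nat)) (j, k)) =
          (\<Sum>j'\<in>UNIV. \<Sum>k'\<in>UNIV. if k' = k then if j' = j then perm_matrix \<sigma> $ j $ k else 0 else 0)"
        by (intro sum.cong refl) (simp add: lookup_single when_def)
      also have "\<dots> = perm_matrix \<sigma> $ j $ k"
        by simp
      finally show ?thesis
        by (simp add: perm_matrix_def)
    qed
    then have "Poly_Mapping.lookup (\<Sum>\<sigma>\<in>Poly_Mapping.keys m. \<Sum>i<Poly_Mapping.lookup m \<sigma>.
        \<Sum>j\<in>UNIV. \<Sum>k\<in>UNIV. \<Sum>i<(perm_matrix \<sigma> :: nat ^ 'a ^ 'a) $ j $ k.
        Poly_Mapping.single (j, k) (1::nat)) (j, k) =
        (\<Sum>\<sigma>\<in>Poly_Mapping.keys m. Poly_Mapping.lookup m \<sigma> * (if j = \<sigma> k then 1 else 0))"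
      by (simp only: lookup_sum sum_constant card_lessThan of_nat_id)
    also have "\<dots> = (\<Sum>\<sigma>\<in>UNIV. Poly_Mapping.lookup m \<sigma> * (if j = \<sigma> k then 1 else 0))"
      by (rule sum.mono_neutral_left) (auto simp: in_keys_iff)
    also have "\<dots> = Poly_Mapping.lookup (toric_weight m) (j, k)"
      unfolding lookup_toric_weight entry_sum_def by (rule sum.cong) auto
    finally show "Poly_Mapping.lookup (\<Sum>\<sigma>\<in>Poly_Mapping.keys m. \<Sum>i<Poly_Mapping.lookup m \<sigma>.
        \<Sum>j\<in>UNIV. \<Sum>k\<in>UNIV. \<Sum>i<(perm_matrix \<sigma> :: nat ^ 'a ^ 'a) $ j $ k.
        Poly_Mapping.single (j, k) (1::nat)) x = Poly_Mapping.lookup (toric_weight m) x"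
      by (simp only: x)
  qed
  have "monom_eval ?a m = Poly_Mapping.single (toric_weight m) 1" for m
    by (simp only: monom_eval_def mvar_def single_1_power prod_single_1 weight)
  then show ?thesis
    by (simp add: toric_map_def mpoly_subst_def mconst_def mult_single flip: monom_eval_def)
qed

lemma toric_map_diff: "toric_map (p - q) = toric_map p - toric_map q"
proof -
  have add: "toric_map (p + q) = toric_map p + toric_map q" for p q
    unfolding toric_map_def by (rule mpoly_subst_add) (simp_all add: mconst_def single_add)
  show ?thesis
    using add[of "p - q" q] by simp
qed

lemma mem_toric_ideal_iff:
  "p \<in> toric_ideal A \<longleftrightarrow> (\<forall>m\<in>Poly_Mapping.keys p. Poly_Mapping.keys m \<subseteq> A) \<and> toric_map p = 0"
  by (simp add: toric_ideal_def a_kernel_def' mpoly_ring_def)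

text \<open>The coefficient of the image at a given weight adds up the coefficients over a fibre. A
  monomial alone in its fibre could not be cancelled.\<close>

lemma toric_ideal_other_monom:
  assumes p: "p \<in> toric_ideal A" and m: "m \<in> Poly_Mapping.keys p"
  obtains m' where "m' \<in> Poly_Mapping.keys p" "m' \<noteq> m" "toric_weight m' = toric_weight m"
proof (rule ccontr)
  assume "\<not> thesis"
  then have unique: "m' = m" if "m' \<in> Poly_Mapping.keys p" "toric_weight m' = toric_weight m" for m'
    using that \<open>(\<And>m'. m' \<in> Poly_Mapping.keys p \<Longrightarrow> m' \<noteq> m \<Longrightarrow> toric_weight m' = toric_weight m \<Longrightarrow> thesis)\<close>
    by blast
  have "Poly_Mapping.lookup (toric_map p) (toric_weight m) =
      (\<Sum>m'\<in>Poly_Mapping.keys p. if m' = m then Poly_Mapping.lookup p m else 0)"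
    unfolding toric_map_eq lookup_sum using unique
    by (intro sum.cong) (auto simp: lookup_single when_def)
  also have "\<dots> \<noteq> 0"
    using m by (simp add: in_keys_iff)
  finally show False
    using p by (simp add: mem_toric_ideal_iff)
qed

lemma binomial_mem_toric_ideal:
  assumes "Poly_Mapping.keys m \<subseteq> A" "Poly_Mapping.keys m' \<subseteq> A" "toric_weight m = toric_weight m'"
  shows "Poly_Mapping.single m 1 - Poly_Mapping.single m' 1 \<in> toric_ideal A"
proof -
  have "Poly_Mapping.keys (Poly_Mapping.single m 1 - Poly_Mapping.single m' (1::complex)) \<subseteq> {m, m'}"
    using keys_diff[of "Poly_Mapping.single m (1::complex)" "Poly_Mapping.single m' 1"] by auto
  moreover have "toric_map (Poly_Mapping.single m 1 - Poly_Mapping.single m' 1) = 0"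
    using assms(3) unfolding toric_map_diff by (simp add: toric_map_eq)
  ultimately show ?thesis
    using assms(1,2) by (auto simp: mem_toric_ideal_iff)
qed

text \<open>Each \<tau> in \<open>m\<close> puts a positive entry at \<open>(\<tau> k, k)\<close>,
  which forces \<open>\<tau> k = \<rho> k\<close> for all \<open>k\<close>; the degree then fixes
  the exponent. Squares are thus excluded as leading monomials of quadrics in the toric
  ideal.\<close>

lemma toric_weight_single_2:
  assumes "toric_weight m = toric_weight (Poly_Mapping.single \<rho> 2)"
  shows "m = Poly_Mapping.single \<rho> 2"
proof -
  have "\<tau> = \<rho>" if "\<tau> \<in> Poly_Mapping.keys m" for \<tau>
  proof
    fix k
    have "Poly_Mapping.lookup m \<tau> \<le> Poly_Mapping.lookup (toric_weight m) (\<tau> k, k)"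
      unfolding lookup_toric_weight entry_sum_def
      using member_le_sum[of \<tau> UNIV "\<lambda>p. if \<tau> k = p k then Poly_Mapping.lookup m p else 0"] by simp
    also have "\<dots> = (\<Sum>p\<in>UNIV. if p = \<rho> then if \<tau> k = p k then 2 else 0 else 0)"
      unfolding assms lookup_toric_weight entry_sum_def
      by (intro sum.cong) (auto simp: lookup_single when_def)
    finally show "\<tau> k = \<rho> k"
      using that by (simp add: in_keys_iff split: if_splits)
  qed
  then have keys: "Poly_Mapping.keys m \<subseteq> {\<rho>}"
    by blast
  then have "Poly_Mapping.lookup m \<rho> = monom_degree m"
    by (simp add: monom_degree_superset[of "{\<rho>}"])
  also have "\<dots> = 2"
    using monom_degree_eq_if_toric_weight_eq[OF assms] by simp
  finally have "Poly_Mapping.lookup m \<rho> = 2" .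
  show ?thesis
  proof (rule poly_mapping_eqI)
    fix \<tau>
    show "Poly_Mapping.lookup m \<tau> = Poly_Mapping.lookup (Poly_Mapping.single \<rho> 2) \<tau>"
      using keys \<open>Poly_Mapping.lookup m \<rho> = 2\<close>
      by (cases "\<tau> = \<rho>") (auto simp: lookup_single_not_eq in_keys_iff subset_iff)
  qed
qed

text \<open>An exponent of at least 2 already exhausts the degree.\<close>

lemma monom_degree_le_2_cases:
  assumes "monom_degree m \<le> 2"
  shows "(\<exists>\<rho>. m = Poly_Mapping.single \<rho> 2) \<or> (\<forall>\<rho>. Poly_Mapping.lookup m \<rho> \<le> 1)"
proof (rule disjCI)
  assume "\<not> (\<forall>\<rho>. Poly_Mapping.lookup m \<rho> \<le> 1)"
  then obtain \<rho> where \<rho>: "Poly_Mapping.lookup m \<rho> \<ge> 2"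
    by (metis Suc_1 not_less_eq_eq)
  have "m = Poly_Mapping.single \<rho> 2 + (m - Poly_Mapping.single \<rho> 2)"
  proof (rule poly_mapping_eqI)
    fix \<tau>
    show "Poly_Mapping.lookup m \<tau> =
        Poly_Mapping.lookup (Poly_Mapping.single \<rho> 2 + (m - Poly_Mapping.single \<rho> 2)) \<tau>"
      using \<rho> by (cases "\<rho> = \<tau>") (simp_all add: lookup_add lookup_minus lookup_single)
  qed
  then obtain n where n: "m = Poly_Mapping.single \<rho> 2 + n"
    by (rule that)
  then have "monom_degree n = 0"
    using assms unfolding n monom_degree_add by simp
  then show "\<exists>\<rho>. m = Poly_Mapping.single \<rho> 2"
    using n by (simp only: monom_degree_eq_0_iff add_0_right) blast
qed

text \<open>A column sum bounds every exponent. Finiteness guarantees a least monomial in each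
  nonempty fibre.\<close>

lemma finite_fibre:
  fixes A :: "('n::finite \<Rightarrow> 'n) set"
  shows "finite {m :: ('n \<Rightarrow> 'n) monom. Poly_Mapping.keys m \<subseteq> A \<and> entry_sum A (Poly_Mapping.lookup m) = e}"
    (is "finite ?F")
proof -
  define k :: 'n where "k = undefined"
  define d where "d = (\<Sum>j\<in>UNIV. e j k)"
  have "Poly_Mapping.lookup m p \<le> d" if m: "m \<in> ?F" for m p
  proof (cases "p \<in> A")
    case True
    then have "Poly_Mapping.lookup m p \<le> (\<Sum>p\<in>A. Poly_Mapping.lookup m p)"
      by (intro member_le_sum) auto
    also have "\<dots> = d"
      using m by (auto simp: d_def simp flip: sum_entry_sum[of A _ k])
    finally show ?thesis .
  next
    case False
    then have "p \<notin> Poly_Mapping.keys m"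
      using m by blast
    then show ?thesis
      by (simp add: in_keys_iff)
  qed
  then have "Poly_Mapping.lookup ` ?F \<subseteq> PiE UNIV (\<lambda>_. {..d})"
    by (auto simp: PiE_def Pi_def)
  then have "finite (Poly_Mapping.lookup ` ?F)"
    by (rule finite_subset) (simp add: finite_PiE)
  moreover have "inj_on Poly_Mapping.lookup ?F"
    by (intro inj_onI poly_mapping_eqI) simp
  ultimately show ?thesis
    by (rule finite_imageD)
qed

text \<open>The least monomial of the fibre of \<open>c\<close> provides the required multiplicities
  \<open>d\<close>.\<close>

theorem quadratic_groebner_imp_sum_saturated:
  fixes A :: "('n::finite \<Rightarrow> 'n) set"
  assumes gb: "\<And>r. linear_order_on A r \<Longrightarrow>
    \<exists>G. is_groebner_basis A (grevlex_less r) (toric_ideal A) G \<and> (\<forall>g\<in>G. total_degree g \<le> 2)"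
  shows "sum_saturated A"
  unfolding sum_saturated_def
proof (intro ballI allI impI)
  fix \<sigma> and c c' :: "_ \<Rightarrow> nat" and N
  assume \<sigma>: "\<sigma> \<in> A" "c' \<sigma> > 0" and eq: "\<forall>j k. N * entry_sum A c j k = entry_sum A c' j k"
  \<comment> \<open>With \<sigma> as the smallest variable, the least monomial of a fibre is one
    with the largest exponent at \<sigma>.\<close>
  obtain r where r: "linear_order_on A r" and least: "\<And>u. (u, \<sigma>) \<in> r \<Longrightarrow> u = \<sigma>"
    using linear_order_on_least_element[OF \<sigma>(1)] by metis
  let ?lt = "grevlex_less r" and ?l = "Poly_Mapping.lookup"
  obtain G where G: "is_groebner_basis A ?lt (toric_ideal A) G" "\<And>g. g \<in> G \<Longrightarrow> total_degree g \<le> 2"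
    using gb[OF r] by blast
  have keys_A: "\<forall>m\<in>Poly_Mapping.keys p. Poly_Mapping.keys m \<subseteq> A" if "p \<in> toric_ideal A" for p
    using that by (simp add: mem_toric_ideal_iff)
  have fin: "finite A"
    by simp
  \<comment> \<open>Multiplicities outside \<open>A\<close> do not affect
    \<open>entry_sum A\<close>; cutting them off yields a monomial in the variables of
    \<open>A\<close>.\<close>
  have restrict: "\<exists>m. Poly_Mapping.keys m \<subseteq> A \<and> (\<forall>p\<in>A. ?l m p = e p)" for e :: "('n \<Rightarrow> 'n) \<Rightarrow> nat"
    by (intro exI[of _ "Abs_poly_mapping (\<lambda>p. if p \<in> A then e p else 0)"]) (auto simp: in_keys_iff split: if_splits)
  have entry_cong: "entry_sum A e = entry_sum A e'" if "\<forall>p\<in>A. e p = e' p" for e e' :: "_ \<Rightarrow> nat"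
    unfolding entry_sum_def fun_eq_iff using that by (intro allI sum.cong) auto
  let ?F = "{m. Poly_Mapping.keys m \<subseteq> A \<and> entry_sum A (?l m) = entry_sum A c}"
  have "?F \<noteq> {}"
    using restrict[of c] entry_cong by blast
  moreover have "transp_on ?F ?lt"
    using grevlex_less_trans[OF r] by (intro transp_onI)
  moreover have "totalp_on ?F ?lt"
    using grevlex_less_total[OF fin r] by (intro totalp_onI) blast
  ultimately obtain m where m: "m \<in> ?F" and m_least: "\<forall>m'\<in>?F. m' \<noteq> m \<longrightarrow> ?lt m m'"
    using Finite_Set.bex_least_element[of ?F ?lt] finite_fibre by blast
  have "?l m \<sigma> > 0"
  proof (rule ccontr)
    assume "\<not> ?l m \<sigma> > 0"
    then have m\<sigma>: "?l m \<sigma> = 0"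
      by simp
    \<comment> \<open>\<open>x\<close> is the \<open>N\<close>-th power of the monomial
      \<open>m\<close>, and \<open>y\<close> encodes \<open>c'\<close>. They share a fibre, but only
      \<open>y\<close> involves \<sigma>, so \<open>y\<close> is smaller and the binomial has
      leading monomial \<open>x\<close>.\<close>
    obtain x where x: "Poly_Mapping.keys x \<subseteq> A" "\<forall>p\<in>A. ?l x p = N * ?l m p"
      using restrict[of "\<lambda>p. N * ?l m p"] by blast
    obtain y where y: "Poly_Mapping.keys y \<subseteq> A" "\<forall>p\<in>A. ?l y p = c' p"
      using restrict[of c'] by blast
    have "entry_sum A (?l x) j k = entry_sum A (?l y) j k" for j k
    proof -
      have "entry_sum A (?l x) j k = N * entry_sum A (?l m) j k"
        unfolding entry_cong[OF x(2)] by (auto simp: entry_sum_def sum_distrib_left intro!: sum.cong)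
      also have "\<dots> = entry_sum A c' j k"
        using m eq by simp
      finally show ?thesis
        unfolding entry_cong[OF y(2)] .
    qed
    then have xy: "toric_weight x = toric_weight y"
      using toric_weight_eq_iff[OF x(1) y(1)] by blast
    have "?l y \<sigma> > ?l x \<sigma>"
      using \<sigma> x(2) y(2) m\<sigma> by simp
    moreover have "\<forall>u. (u, \<sigma>) \<in> r \<and> u \<noteq> \<sigma> \<longrightarrow> ?l y u = ?l x u"
      using least by blast
    ultimately have "?lt y x"
      unfolding grevlex_less_def linear_order_onD(1)[OF r]
      using monom_degree_eq_if_toric_weight_eq[OF xy] \<sigma>(1) by auto
    let ?f = "Poly_Mapping.single x 1 - Poly_Mapping.single y 1 :: ('n \<Rightarrow> 'n, complex) mpoly"
    have "x \<noteq> y"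
      using \<open>?lt y x\<close> grevlex_less_irrefl by blast
    then have keys_f: "Poly_Mapping.keys ?f = {x, y}"
      by (auto simp: in_keys_iff lookup_minus lookup_single when_def split: if_splits)
    then have "?f \<noteq> 0"
      by (metis insert_not_empty keys_zero)
    have f: "?f \<in> toric_ideal A"
      by (rule binomial_mem_toric_ideal[OF x(1) y(1) xy])
    have "lead_monom ?lt ?f = x"
    proof (rule ccontr)
      assume neq: "lead_monom ?lt ?f \<noteq> x"
      note lead = lead_monom_grevlex[OF fin r \<open>?f \<noteq> 0\<close> keys_A[OF f]]
      have "lead_monom ?lt ?f = y"
        using lead(1) neq unfolding keys_f by blast
      then have "?lt x y"
        using lead(2)[of x] neq unfolding keys_f by simp
      then show False
        using \<open>?lt y x\<close> grevlex_less_trans[OF r] grevlex_less_irrefl by blast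
    qed
    moreover have "Poly_Mapping.single (lead_monom ?lt ?f) 1 \<in> initial_ideal A ?lt (toric_ideal A)"
      using f \<open>?f \<noteq> 0\<close> unfolding initial_ideal_def genideal_def by blast
    ultimately have x_init: "Poly_Mapping.single x 1 \<in> initial_ideal A ?lt G"
      using G(1) by (simp add: is_groebner_basis_def)
    have GI: "G \<subseteq> toric_ideal A"
      using G(1) by (simp add: is_groebner_basis_def)
    have lead_G: "lead_monom ?lt g \<in> Poly_Mapping.keys g" if "g \<in> G" "g \<noteq> 0" for g
      by (rule lead_monom_grevlex(1)[OF fin r that(2) keys_A[OF subsetD[OF GI that(1)]]])
    then have lead_A: "\<forall>g\<in>G - {0}. Poly_Mapping.keys (lead_monom ?lt g) \<subseteq> A"
      using keys_A GI by blast
    have "x \<in> Poly_Mapping.keys (Poly_Mapping.single x (1 :: complex))"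
      by simp
    from initial_ideal_keys_divisible[OF lead_A x_init this]
    obtain g n where g: "g \<in> G" "g \<noteq> 0" and x_eq: "x = lead_monom ?lt g + n"
      by blast
    define u where "u = lead_monom ?lt g"
    have u: "u \<in> Poly_Mapping.keys g"
      unfolding u_def by (rule lead_G[OF g])
    have gI: "g \<in> toric_ideal A"
      using GI g(1) by blast
    \<comment> \<open>The leading monomial \<open>u\<close> has a companion of equal weight in
      \<open>g\<close>, which is smaller because it is not leading.\<close>
    obtain u' where u': "u' \<in> Poly_Mapping.keys g" "u' \<noteq> u" "toric_weight u' = toric_weight u"
      using toric_ideal_other_monom[OF gI u] by metis
    have lt_u: "?lt u' u"
      using lead_monom_grevlex(2)[OF fin r g(2) keys_A[OF gI] u'(1)] u'(2) unfolding u_def by blast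
    have "monom_degree u \<le> 2"
      using G(2)[OF g(1)] u by (simp add: total_degree_le_iff)
    moreover have "u \<noteq> Poly_Mapping.single \<rho> 2" for \<rho>
      using toric_weight_single_2[of u' \<rho>] u' by metis
    ultimately have sqfree: "?l u p \<le> 1" for p
      using monom_degree_le_2_cases by blast
    \<comment> \<open>\<open>u\<close> divides the power \<open>x\<close>, so its variables occur in
      \<open>m\<close>; being squarefree, it divides \<open>m\<close> itself.\<close>
    have u_le_m: "?l u p \<le> ?l m p" for p
    proof (cases "p \<in> A \<and> ?l m p > 0")
      case True
      then show ?thesis
        using sqfree[of p] by simp
    next
      case False
      then have "?l x p = 0"
        using x by (cases "p \<in> A") (auto simp: in_keys_iff subset_iff)
      then show ?thesis
        using x_eq by (simp add: u_def lookup_add)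
    qed
    \<comment> \<open>Exchanging the factor \<open>u\<close> of \<open>m\<close> for
      \<open>u'\<close> stays in the fibre and gives a smaller monomial, against the choice of
      \<open>m\<close>.\<close>
    define w where "w = m - u"
    have m_eq: "m = u + w"
      by (rule poly_mapping_eqI) (use u_le_m in \<open>simp add: w_def lookup_add lookup_minus\<close>)
    have "Poly_Mapping.keys w \<subseteq> Poly_Mapping.keys m"
      by (auto simp: m_eq in_keys_iff lookup_add)
    then have keys': "Poly_Mapping.keys (u' + w) \<subseteq> A"
      using keys_add[of u' w] keys_A[OF gI] u'(1) m by blast
    moreover have "toric_weight (u' + w) = toric_weight m"
      by (simp add: m_eq toric_weight_add u'(3))
    ultimately have "u' + w \<in> ?F"
      using m toric_weight_eq_iff[of "u' + w" A m] by simp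
    moreover have less: "?lt (u' + w) m"
      unfolding m_eq grevlex_less_add_cancel by (rule lt_u)
    moreover have "u' + w \<noteq> m"
      using less grevlex_less_irrefl by metis
    ultimately have "?lt m m"
      using m_least grevlex_less_trans[OF r] by blast
    then show False
      using grevlex_less_irrefl by blast
  qed
  then show "\<exists>d. d \<sigma> > 0 \<and> entry_sum A d = entry_sum A c"
    using m by blast
qed

theorem theorem4p6:
  fixes A :: "('n::finite \<Rightarrow> 'n) set"
  assumes "subgroup A (BijGroup UNIV)"
  shows "(permutation_summable A \<longrightarrow> theta_exact A) \<and>
    ((\<forall>r. linear_order_on A r \<longrightarrow>
        (\<exists>G. is_groebner_basis A (grevlex_less r) (toric_ideal A) G \<and>
             (\<forall>g\<in>G. total_degree g = 2)))
      \<longrightarrow> theta_exact A)"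
proof (intro conjI impI)
  assume "permutation_summable A"
  then show "theta_exact A"
    by (intro sum_saturated_imp_theta_exact permutation_summable_imp_sum_saturated assms)
next
  assume gb: "\<forall>r. linear_order_on A r \<longrightarrow>
    (\<exists>G. is_groebner_basis A (grevlex_less r) (toric_ideal A) G \<and> (\<forall>g\<in>G. total_degree g = 2))"
  have "sum_saturated A"
  proof (rule quadratic_groebner_imp_sum_saturated)
    fix r
    assume "linear_order_on A r"
    then obtain G where "is_groebner_basis A (grevlex_less r) (toric_ideal A) G"
      "\<forall>g\<in>G. total_degree g = 2"
      using gb by blast
    then show "\<exists>G. is_groebner_basis A (grevlex_less r) (toric_ideal A) G \<and>
        (\<forall>g\<in>G. total_degree g \<le> 2)"
      by (intro exI[of _ G]) simp
  qed
  then show "theta_exact A"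
    by (rule sum_saturated_imp_theta_exact)
qed

end
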